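(* Let $1\leq r<\infty$ be given and let the dominated model $\mathscr{P}$ be a totally bounded metric space with respect to $d_r$. Let $X_1,X_2,\ldots$ be i.i.d.-$P_0$ distributed for some $P_0\in\mathscr{P}$. Assume that the prior $\Pi$ is such that $P_0^n\ll P_n^\Pi$ for all $n\geq1$ and satisfies \[ \Pi\bigl(P\in\mathscr{P}:d_r(P_0,P)<\delta\bigr)>0 \] for all $\delta>0$. In addition, assume that there are an $L>0$ and a $d_r$-ball $B$ (centred on $P_0$) such that for all $P\in\mathscr{P}$ and $Q\in B$, \[ P_0\Bigl(\frac{p}{q}\Bigr)^{(s/r)\vee1}\leq L^s,\qquad\text{where }\frac1r+\frac1s=1. \] Then the posterior is consistent in the $d_r$-metric, $P_0$-almost surely: for every $\epsilon>0$, $\Pi(P\in\mathscr{P}:d_r(P,P_0)>\epsilon\mid X_1,\ldots,X_n)\to0$, $P_0$-almost surely.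
   Context: Setting. $(\mathscr{X},\mathscr{A})$ is a measurable space (the sample space). The model $\mathscr{P}$ is a collection of probability measures on $(\mathscr{X},\mathscr{A})$ dominated by a $\sigma$-finite measure $\mu$, with densities $p=dP/d\mu$, $q=dQ/d\mu$; it carries a $\sigma$-algebra $\mathscr{B}$ such that $P\mapsto P(A)$ is measurable for every $A\in\mathscr{A}$ (densities are taken measurable in $(x,P)$, and model subsets to which $\Pi$ is applied are measurable). The prior $\Pi$ is a probability measure on $(\mathscr{P},\mathscr{B})$. Notation: $P_0f=\int f\,dP_0$. The prior predictive distributions are $P_n^\Pi(A)=\int P^n(A)\,d\Pi(P)$. The posterior is \[ \Pi(A\mid X_1,\ldots,X_n)=\int_A\prod_{i=1}^n p(X_i)\,d\Pi(P)\Bigm/\int_{\mathscr{P}}\prod_{i=1}^n p(X_i)\,d\Pi(P). \] "$P_0$-almost surely" refers to $P_0^\infty$. Matusita's $r$-metric distance is $d_r(P,Q)=\bigl(\int|p^{1/r}-q^{1/r}|^r\,d\mu\bigr)^{1/r}$. Conventions: $P_0(p/q)^\beta=\int_{\{p_0>0,\,p>0\}}(p/q)^\beta\,dP_0$, its finiteness including that $q>0$ $P_0$-almost everywhere on $\{p>0\}$. For $r=1$ one has $s=\infty$ and the last condition is read in the limiting sense, as a uniform bound by $L$ on the $P_0$-essential supremum of $p/q$. *)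

theory Defs
  imports "HOL-Probability.Probability"
begin

text \<open>
  A dominated model with a prior. The prior carries the \<open>\<sigma>\<close>-algebra of the model, and
  \<open>p P\<close> is the chosen version of the density of \<open>P\<close> with respect to \<open>\<mu>\<close>, measurable jointly
  in the observation and the model point. By joint measurability and the \<open>\<sigma>\<close>-finiteness
  of \<open>\<mu>\<close>, all \<open>d\<^sub>r\<close>-balls of the model are measurable, so this is not assumed separately.
\<close>

locale dominated_bayes_model =
  sigma_finite_measure \<mu> + prior: prob_space prior
  for \<mu> :: "'a measure"
    and model :: "'a measure set"
    and p :: "'a measure \<Rightarrow> 'a \<Rightarrow> real"
    and prior :: "'a measure measure" +
  assumes space_prior: "space prior = model"
    and prob_space_model: "P \<in> model \<Longrightarrow> prob_space P"
    and sets_model: "P \<in> model \<Longrightarrow> sets P = sets \<mu>"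
    and emeasure_measurable: "A \<in> sets \<mu> \<Longrightarrow> (\<lambda>P. emeasure P A) \<in> borel_measurable prior"
    and density_nonneg: "P \<in> model \<Longrightarrow> x \<in> space \<mu> \<Longrightarrow> 0 \<le> p P x"
    and density_measurable: "(\<lambda>(x, P). p P x) \<in> borel_measurable (\<mu> \<Otimes>\<^sub>M prior)"
    and model_eq_density: "P \<in> model \<Longrightarrow> P = density \<mu> (\<lambda>x. ennreal (p P x))"

text \<open>
  The integrand below is at most \<open>\<bar>p P x - p Q x\<bar>\<close>, hence integrable for model points, so
  the Bochner integral never takes its default value there.
\<close>

definition matusita_dist ::
    "'a measure \<Rightarrow> ('a measure \<Rightarrow> 'a \<Rightarrow> real) \<Rightarrow> real \<Rightarrow> 'a measure \<Rightarrow> 'a measure \<Rightarrow> real" where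
  "matusita_dist \<mu> p r P Q =
     (\<integral>x. \<bar>p P x powr (1 / r) - p Q x powr (1 / r)\<bar> powr r \<partial>\<mu>) powr (1 / r)"

definition iid_sample :: "'a measure \<Rightarrow> nat \<Rightarrow> (nat \<Rightarrow> 'a) measure" where
  "iid_sample P n = PiM {..<n} (\<lambda>_. P)"

definition iid_sequence :: "'a measure \<Rightarrow> (nat \<Rightarrow> 'a) measure" where
  "iid_sequence P = PiM UNIV (\<lambda>_. P)"

text \<open>
  The prior predictive distribution as a mixture; the lemma \<open>emeasure_prior_predictive\<close> below
  gives it in the form \<open>P\<^sub>n\<^sup>\<Pi>(A) = \<integral> P\<^sup>n(A) d\<Pi>(P)\<close>.
\<close>

definition prior_predictive :: "'a measure measure \<Rightarrow> nat \<Rightarrow> (nat \<Rightarrow> 'a) measure" where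
  "prior_predictive prior n = prior \<bind> (\<lambda>P. iid_sample P n)"

text \<open>
  The observations \<open>X\<^sub>1, \<dots>, X\<^sub>n\<close> are \<open>\<omega> 0, \<dots>, \<omega> (n - 1)\<close>. In \<^typ>\<open>ennreal\<close>, the
  quotient is \<open>0\<close> when the denominator is \<open>0\<close> (both integrals then vanish) or \<open>\<infinity>\<close>. If \<open>P\<^sub>0\<^sup>n\<close> is dominated by the prior predictive distribution, these cases
  do not occur almost surely.
\<close>

definition posterior ::
    "('a measure \<Rightarrow> 'a \<Rightarrow> real) \<Rightarrow> 'a measure measure \<Rightarrow> nat \<Rightarrow> (nat \<Rightarrow> 'a) \<Rightarrow> 'a measure set \<Rightarrow> ennreal" where
  "posterior p prior n \<omega> A =
     (\<integral>\<^sup>+ P \<in> A. (\<Prod>i<n. ennreal (p P (\<omega> i))) \<partial>prior) /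
     (\<integral>\<^sup>+ P. (\<Prod>i<n. ennreal (p P (\<omega> i))) \<partial>prior)"

text \<open>
  \<open>P\<^sub>0 (p/q)\<^sup>\<beta>\<close>, with the value \<open>\<infinity>\<close> for the integrand where \<open>q = 0 < p\<close>: finiteness forces
  \<open>q > 0\<close> almost everywhere under \<open>P\<^sub>0\<close> on \<open>{p > 0}\<close>.
\<close>

definition likelihood_ratio_moment ::
    "('a measure \<Rightarrow> 'a \<Rightarrow> real) \<Rightarrow> 'a measure \<Rightarrow> 'a measure \<Rightarrow> 'a measure \<Rightarrow> real \<Rightarrow> ennreal" where
  "likelihood_ratio_moment p P\<^sub>0 P Q \<beta> =
     (\<integral>\<^sup>+ x \<in> {x. 0 < p P\<^sub>0 x \<and> 0 < p P x}.
        (if p Q x = 0 then \<infinity> else ennreal ((p P x / p Q x) powr \<beta>)) \<partial>P\<^sub>0)"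

text \<open>
  For \<open>r > 1\<close> the number \<open>s = r / (r - 1)\<close> is the solution of \<open>1/r + 1/s = 1\<close>. For \<open>r = 1\<close>,
  where \<open>s = \<infinity>\<close>, the bound is on the essential supremum; the quotient in \<^typ>\<open>ennreal\<close> is \<open>0\<close>
  where \<open>p = 0\<close> (also if \<open>q = 0\<close>) and \<open>\<infinity>\<close> where \<open>q = 0 < p\<close>.
\<close>

definition likelihood_ratio_bounded ::
    "('a measure \<Rightarrow> 'a \<Rightarrow> real) \<Rightarrow> real \<Rightarrow> real \<Rightarrow> 'a measure \<Rightarrow> 'a measure \<Rightarrow> 'a measure \<Rightarrow> bool" where
  "likelihood_ratio_bounded p r L P\<^sub>0 P Q \<longleftrightarrow>
     (if r = 1 then esssup P\<^sub>0 (\<lambda>x. ennreal (p P x) / ennreal (p Q x)) \<le> ennreal L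
      else let s = r / (r - 1) in
        likelihood_ratio_moment p P\<^sub>0 P Q (max (s / r) 1) \<le> ennreal (L powr s))"

context dominated_bayes_model
begin

lemma iid_sample_measurable:
  "(\<lambda>P. iid_sample P n) \<in> prior \<rightarrow>\<^sub>M subprob_algebra (PiM {..<n} (\<lambda>_. \<mu>))"
proof (rule measurable_subprob_algebra_generated[OF sets_PiM])
  show "Int_stable (prod_algebra {..<n} (\<lambda>_. \<mu>))"
    by (rule Int_stable_prod_algebra)
  show "prod_algebra {..<n} (\<lambda>_. \<mu>) \<subseteq> Pow (\<Pi>\<^sub>E i\<in>{..<n}. space \<mu>)"
    by (rule prod_algebra_sets_into_space)
next
  fix P assume in_space: "P \<in> space prior"
  then interpret prob_space P
    using prob_space_model space_prior by simp
  interpret product_prob_space "\<lambda>_::nat. P" "{..<n}" ..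
  show "subprob_space (iid_sample P n)"
    unfolding iid_sample_def by (rule prob_space_imp_subprob_space) (rule prob_space_axioms)
  show "sets (iid_sample P n) = sets (PiM {..<n} (\<lambda>_. \<mu>))"
    unfolding iid_sample_def by (intro sets_PiM_cong refl sets_model) (use in_space space_prior in simp)
next
  have box: "(\<lambda>P. emeasure (iid_sample P n) (Pi\<^sub>E {..<n} E)) \<in> borel_measurable prior"
    if E: "\<And>i. i < n \<Longrightarrow> E i \<in> sets \<mu>" for E
  proof -
    have "emeasure (iid_sample P n) (Pi\<^sub>E {..<n} E) = (\<Prod>i<n. emeasure P (E i))"
      if "P \<in> space prior" for P
    proof -
      interpret prob_space P
        using that prob_space_model space_prior by simp
      interpret product_sigma_finite "\<lambda>_::nat. P" ..
      show ?thesis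
        unfolding iid_sample_def using that E sets_model space_prior
        by (intro emeasure_PiM) auto
    qed
    moreover have "(\<lambda>P. \<Prod>i<n. emeasure P (E i)) \<in> borel_measurable prior"
      using E emeasure_measurable by (intro borel_measurable_prod_ennreal) auto
    ultimately show ?thesis
      by (simp cong: measurable_cong)
  qed
  show "(\<lambda>P. emeasure (iid_sample P n) A) \<in> borel_measurable prior"
    if "A \<in> prod_algebra {..<n} (\<lambda>_. \<mu>)" for A
    using that box by (auto simp: prod_algebra_eq_finite)
  show "(\<lambda>P. emeasure (iid_sample P n) (\<Pi>\<^sub>E i\<in>{..<n}. space \<mu>)) \<in> borel_measurable prior"
    by (rule box) simp
qed

lemma sets_prior_predictive: "sets (prior_predictive prior n) = sets (PiM {..<n} (\<lambda>_. \<mu>))"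
  unfolding prior_predictive_def
proof (rule sets_bind[OF _ prior.not_empty])
  show "sets (iid_sample P n) = sets (PiM {..<n} (\<lambda>_. \<mu>))" if "P \<in> space prior" for P
    unfolding iid_sample_def by (intro sets_PiM_cong refl sets_model) (use that space_prior in simp)
qed

lemma emeasure_prior_predictive:
  assumes "A \<in> sets (PiM {..<n} (\<lambda>_. \<mu>))"
  shows "emeasure (prior_predictive prior n) A = (\<integral>\<^sup>+ P. emeasure (iid_sample P n) A \<partial>prior)"
  unfolding prior_predictive_def
  using prior.not_empty iid_sample_measurable assms by (rule emeasure_bind)

end

end

theory Submission
  imports Defs
begin

text \<open>
  Everything reduces to the \<open>L\<^sup>1\<close> distance of the densities: \<open>d\<^sub>r\<^sup>r\<close> is at most this distance,
  which conversely is small where \<open>d\<^sub>r\<close> is small. The moment condition, used for \<open>P = P\<^sub>0\<close> only,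
  bounds \<open>P\<^sub>0(p\<^sub>0/q)\<close> near \<open>P\<^sub>0\<close>, so that \<open>P\<^sub>0(p\<^sub>0/q)\<^sup>1\<^sup>/\<^sup>2 \<le> 1 + \<eta>\<close> for \<open>Q\<close> in a neighbourhood
  of positive prior mass. By Markov's inequality and the Borel-Cantelli lemma, the normalised
  denominator of the posterior therefore eventually exceeds any given exponentially small sequence.

  By total boundedness, the complement of the \<open>\<epsilon>\<close>-ball is covered by finitely many sets \<open>V\<close>, small in
  \<open>L\<^sup>1\<close>, on each of which \<open>P(A) \<ge> P\<^sub>0(A) + 2\<kappa>\<close> for some event \<open>A\<close>. A suitable affine function \<open>g\<close> of
  the indicator of \<open>A\<close> has \<open>P g \<le> \<gamma>\<close> on \<open>V\<close> and \<open>P\<^sub>0(1/g) \<le> \<gamma>\<close> for some \<open>\<gamma> < 1\<close>. Hence the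
  numerator, weighted by \<open>\<Prod>g(X\<^sub>i)\<close>, and the weight \<open>\<Prod>1/g(X\<^sub>i)\<close> both decay exponentially, almost surely.
\<close>

subsection \<open>Inequalities between powers and roots\<close>

text \<open>For \<open>r \<ge> 1\<close> the map \<open>x \<mapsto> x powr r\<close> is
  superadditive on the nonnegative reals; this is applied to the smaller root and the difference of
  the two roots.\<close>

lemma powr_root_diff_le:
  fixes a b r :: real
  assumes r: "1 \<le> r" and "0 \<le> a" "0 \<le> b"
  shows "\<bar>a powr (1 / r) - b powr (1 / r)\<bar> powr r \<le> \<bar>a - b\<bar>"
proof -
  have superadditive: "(u - v) powr r \<le> u powr r - v powr r" if "0 \<le> v" "v \<le> u" for u v :: real
  proof -
    have base: "x powr r = x * x powr (r - 1)" if "0 \<le> x" for x :: real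
      using that powr_mult_base[of x "r - 1"] by simp
    \<comment> \<open>Both \<open>u - v\<close> and \<open>v\<close> are at most \<open>u\<close>,
      so their powers with exponent \<open>r - 1\<close> are at most \<open>u powr (r - 1)\<close>.
      Adding the two bounds gives \<open>(u - v) powr r + v powr r \<le> u powr r\<close>.\<close>
    have "(u - v) * (u - v) powr (r - 1) \<le> (u - v) * u powr (r - 1)"
      using that r by (intro mult_left_mono powr_mono2) auto
    moreover have "v * v powr (r - 1) \<le> v * u powr (r - 1)"
      using that r by (intro mult_left_mono powr_mono2) auto
    ultimately show ?thesis
      using that by (simp add: base algebra_simps)
  qed
  have ordered: "\<bar>a powr (1 / r) - b powr (1 / r)\<bar> powr r \<le> \<bar>a - b\<bar>"
    if "0 \<le> b" "b \<le> a" for a b :: real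
  proof -
    have "b powr (1 / r) \<le> a powr (1 / r)"
      using that r by (intro powr_mono2) auto
    then show ?thesis
      using superadditive[of "b powr (1 / r)" "a powr (1 / r)"] that r by (simp add: powr_powr)
  qed
  show ?thesis
    using ordered[of a b] ordered[of b a] assms
    by (cases "b \<le> a") (simp_all add: abs_minus_commute)
qed

text \<open>A converse up to a small relative error. Either the smaller number is within a factor
  close to 1 of the larger, or the roots differ by a fixed fraction of the larger root, whose
  \<open>r\<close>-th power then controls everything. Since \<open>C\<close> depends on
  \<open>r\<close> and \<open>\<delta>\<close> only, the bound can be integrated uniformly over the
  model.\<close>

lemma diff_le_powr_root_diff:
  fixes r \<delta> :: real
  assumes r: "1 \<le> r" and \<delta>: "0 < \<delta>"
  obtains C where "0 \<le> C"
    "\<And>a b. 0 \<le> a \<Longrightarrow> 0 \<le> b \<Longrightarrow>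
      \<bar>a - b\<bar> \<le> \<delta> * (a + b) + C * \<bar>a powr (1 / r) - b powr (1 / r)\<bar> powr r"
proof
  \<comment> \<open>The cap \<open>1 / 2\<close> keeps \<open>1 - \<delta>'\<close> positive, so
    that \<open>h\<close>, the threshold for the ratio of the roots, lies strictly between 0 and 1
    and \<open>1 - h\<close> can be divided by.\<close>
  define \<delta>' where "\<delta>' = min \<delta> (1 / 2)"
  define h where "h = (1 - \<delta>') powr (1 / r)"
  define C where "C = 1 / (1 - h) powr r"
  have \<delta>': "0 < \<delta>'" "\<delta>' \<le> 1 / 2" "\<delta>' \<le> \<delta>"
    using \<delta> by (auto simp: \<delta>'_def)
  have h: "0 < h" "h < 1" "h powr r = 1 - \<delta>'"
    using \<delta>' r powr_less_mono2[of "1 / r" "1 - \<delta>'" 1] by (auto simp: h_def powr_powr)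
  show "0 \<le> C"
    by (simp add: C_def)
  have ordered: "\<bar>a - b\<bar> \<le> \<delta> * (a + b) + C * \<bar>a powr (1 / r) - b powr (1 / r)\<bar> powr r"
    if "0 \<le> b" "b \<le> a" for a b :: real
  proof (cases "h * a powr (1 / r) \<le> b powr (1 / r)")
    case True
    then have "(h * a powr (1 / r)) powr r \<le> (b powr (1 / r)) powr r"
      using h r by (intro powr_mono2) auto
    then have "(1 - \<delta>') * a \<le> b"
      using that r h by (simp add: powr_mult powr_powr)
    then have "a - b \<le> \<delta>' * a"
      by (simp add: algebra_simps)
    also have "\<dots> \<le> \<delta> * (a + b)"
      using that \<delta>' \<delta> by (intro mult_mono) auto
    finally show ?thesis
      using that \<open>0 \<le> C\<close> by (simp add: add_increasing2)
  next
    case False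
    \<comment> \<open>Below the threshold the smaller root is less than \<open>h\<close> times the
      larger, so the roots differ by more than \<open>1 - h\<close> times the larger.\<close>
    then have "((1 - h) * a powr (1 / r)) powr r \<le> \<bar>a powr (1 / r) - b powr (1 / r)\<bar> powr r"
      using h r mult_right_mono[of h 1 "a powr (1 / r)"]
      by (intro powr_mono2) (auto simp: algebra_simps)
    then have "(1 - h) powr r * a \<le> \<bar>a powr (1 / r) - b powr (1 / r)\<bar> powr r"
      using that r h by (simp add: powr_mult powr_powr)
    then have "a \<le> C * \<bar>a powr (1 / r) - b powr (1 / r)\<bar> powr r"
      using h by (simp add: C_def field_simps)
    moreover have "\<bar>a - b\<bar> \<le> a" "0 \<le> \<delta> * (a + b)"
      using that \<delta> by auto
    ultimately show ?thesis
      by linarith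
  qed
  show "\<bar>a - b\<bar> \<le> \<delta> * (a + b) + C * \<bar>a powr (1 / r) - b powr (1 / r)\<bar> powr r"
    if "0 \<le> a" "0 \<le> b" for a b :: real
    using ordered[of a b] ordered[of b a] that
    by (cases "b \<le> a") (simp_all add: abs_minus_commute add.commute)
qed

text \<open>
  With \<open>v = sqrt (a / b)\<close>, the first term suffices if \<open>v \<le> 1 + \<delta>\<close>. Otherwise
  \<open>a \<le> (1 + 1 / \<delta>) (a - b)\<close>, and \<open>a v \<le> \<kappa> a v\<^sup>2 + a / (4 \<kappa>)\<close> by AM-GM.
\<close>

lemma mult_sqrt_ratio_le:
  fixes a b \<delta> \<kappa> :: real
  assumes "0 \<le> a" "0 \<le> b" "0 < \<delta>" "0 < \<kappa>"
  shows "ennreal a * (ennreal (sqrt a) / ennreal (sqrt b)) \<le>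
    ennreal ((1 + \<delta>) * a) + ennreal \<kappa> * (ennreal a * (ennreal a / ennreal b)) +
    ennreal ((1 + 1 / \<delta>) / (4 * \<kappa>) * \<bar>a - b\<bar>)"
proof -
  consider "a = 0" | "0 < a" "b = 0" | "0 < a" "0 < b"
    using assms by fastforce
  then show ?thesis
  proof cases
    \<comment> \<open>Here \<open>a / b\<close> is infinite, and \<open>\<kappa> > 0\<close> makes
      the right-hand side infinite as well.\<close>
    case 2
    then show ?thesis
      using assms by (simp add: ennreal_mult_top)
  next
    case 3
    define v where "v = sqrt (a / b)"
    have v: "0 < v" "v * v = a / b"
      using 3 by (auto simp: v_def)
    have c: "0 \<le> (1 + 1 / \<delta>) / (4 * \<kappa>)"
      using assms by simp
    have "a * v \<le> (1 + \<delta>) * a + \<kappa> * (a * (a / b)) + (1 + 1 / \<delta>) / (4 * \<kappa>) * \<bar>a - b\<bar>"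
    proof (cases "v \<le> 1 + \<delta>")
      case True
      then have "a * v \<le> (1 + \<delta>) * a"
        using 3 by (simp add: mult.commute)
      moreover have "0 \<le> \<kappa> * (a * (a / b))" "0 \<le> (1 + 1 / \<delta>) / (4 * \<kappa>) * \<bar>a - b\<bar>"
        using 3 assms c by (auto intro!: mult_nonneg_nonneg simp del: times_divide_eq_left)
      ultimately show ?thesis by linarith
    next
      case False
      \<comment> \<open>Since \<open>v > 1\<close>, also \<open>a / b = v * v\<close> exceeds
        \<open>1 + \<delta>\<close>, so \<open>a\<close> and \<open>b\<close> differ by a fixed
        fraction of \<open>a\<close>.\<close>
      have "1 + \<delta> \<le> v * v"
        using False assms mult_mono[of 1 v "1 + \<delta>" v] by auto
      then have "(1 + \<delta>) * b \<le> a"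
        using v 3 by (simp add: field_simps)
      then have "\<delta> * a \<le> (1 + \<delta>) * (a - b)"
        by (simp add: algebra_simps)
      moreover have "b \<le> a"
        using \<open>(1 + \<delta>) * b \<le> a\<close> assms mult_right_mono[of 1 "1 + \<delta>" b] by linarith
      ultimately have "a \<le> (1 + 1 / \<delta>) * \<bar>a - b\<bar>"
        using assms by (simp add: field_simps)
      then have "a / (4 * \<kappa>) \<le> (1 + 1 / \<delta>) * \<bar>a - b\<bar> / (4 * \<kappa>)"
        using assms by (intro divide_right_mono) auto
      moreover have "v \<le> \<kappa> * (v * v) + 1 / (4 * \<kappa>)"
      proof -
        have "0 \<le> (2 * \<kappa> * v - 1)\<^sup>2" by simp
        then show ?thesis
          using assms by (simp add: field_simps power2_eq_square)
      qed
      then have "a * v \<le> a * (\<kappa> * (v * v) + 1 / (4 * \<kappa>))"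
        using assms by (intro mult_left_mono)
      then have "a * v \<le> \<kappa> * (a * (a / b)) + a / (4 * \<kappa>)"
        by (simp add: v algebra_simps)
      moreover have "0 \<le> (1 + \<delta>) * a"
        using assms by simp
      ultimately show ?thesis by simp
    qed
    moreover have "ennreal a * (ennreal (sqrt a) / ennreal (sqrt b)) = ennreal (a * v)"
      using 3 by (simp add: divide_ennreal ennreal_mult[symmetric] v_def real_sqrt_divide)
    moreover have "ennreal ((1 + \<delta>) * a) + ennreal \<kappa> * (ennreal a * (ennreal a / ennreal b)) +
      ennreal ((1 + 1 / \<delta>) / (4 * \<kappa>) * \<bar>a - b\<bar>)
      = ennreal ((1 + \<delta>) * a + \<kappa> * (a * (a / b)) + (1 + 1 / \<delta>) / (4 * \<kappa>) * \<bar>a - b\<bar>)"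
      using 3 assms c
      by (simp add: divide_ennreal ennreal_plus ennreal_mult[symmetric] del: ennreal_plus[symmetric] times_divide_eq_left)
    ultimately show ?thesis
      by (simp add: ennreal_leI)
  qed simp
qed

subsection \<open>Exponential decay along an i.i.d. sequence\<close>

lemma divide_mono_ennreal:
  fixes a b c d :: ennreal
  assumes "a \<le> b" "d \<le> c"
  shows "a / c \<le> b / d"
proof -
  have "inverse c \<le> inverse d"
  \<comment> \<open>In the excluded cases \<open>inverse d\<close> is infinite or
    \<open>inverse c\<close> is zero; otherwise both numbers are finite and positive, and the real
    inequality applies.\<close>
  proof (cases "d = 0 \<or> c = top")
    case False
    then obtain c' d' where "c = ennreal c'" "d = ennreal d'" "0 < d'" "d' \<le> c'"
      using assms(2) by (cases c; cases d) (auto simp: less_le top_unique)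
    then show ?thesis
      by (simp add: inverse_ennreal ennreal_leI le_imp_inverse_le)
  qed auto
  then show ?thesis
    unfolding divide_ennreal_def using assms(1) by (intro mult_mono) auto
qed

text \<open>Markov's inequality bounds the measure of \<open>X n > \<sigma> ^ n\<close> by
  \<open>(\<gamma> / \<sigma>) ^ n\<close>, which is summable because
  \<open>\<gamma> < \<sigma>\<close>; Borel-Cantelli does the rest. The rates may exceed 1.\<close>

lemma AE_eventually_le_power:
  fixes X :: "nat \<Rightarrow> 'a \<Rightarrow> ennreal" and \<gamma> \<sigma> :: real
  assumes X [measurable]: "\<And>n. X n \<in> borel_measurable M"
    and bound: "\<And>n. (\<integral>\<^sup>+ x. X n x \<partial>M) \<le> ennreal (\<gamma> ^ n)"
    and \<gamma>: "0 \<le> \<gamma>" "\<gamma> < \<sigma>"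
  shows "AE x in M. eventually (\<lambda>n. X n x \<le> ennreal (\<sigma> ^ n)) sequentially"
proof -
  have \<sigma>: "0 < \<sigma>" using \<gamma> by simp
  define A where "A n = {x \<in> space M. ennreal (\<sigma> ^ n) < X n x}" for n
  have A [measurable]: "A n \<in> sets M" for n
    unfolding A_def by measurable
  have le: "emeasure M (A n) \<le> ennreal ((\<gamma> / \<sigma>) ^ n)" for n
  proof -
    have "ennreal (\<sigma> ^ n) * emeasure M (A n) = (\<integral>\<^sup>+ x. ennreal (\<sigma> ^ n) * indicator (A n) x \<partial>M)"
      by (simp add: nn_integral_cmult_indicator)
    also have "\<dots> \<le> (\<integral>\<^sup>+ x. X n x \<partial>M)"
      by (intro nn_integral_mono) (auto simp: A_def indicator_def)
    also have "\<dots> \<le> ennreal (\<gamma> ^ n)"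
      by (rule bound)
    finally have "ennreal (\<sigma> ^ n) * emeasure M (A n) / ennreal (\<sigma> ^ n) \<le> ennreal (\<gamma> ^ n) / ennreal (\<sigma> ^ n)"
      by (rule divide_right_mono_ennreal)
    then show ?thesis
      using \<gamma> \<sigma> by (simp add: divide_ennreal power_divide mult.commute[of "ennreal _" "emeasure _ _"]
          mult_divide_eq_ennreal)
  qed
  have "AE x in M. eventually (\<lambda>n. x \<in> space M - A n) sequentially"
  proof (rule borel_cantelli_AE1[OF A])
    show "emeasure M (A n) < \<infinity>" for n
      using le[of n] by (auto simp: top_unique less_top[symmetric])
    have "measure M (A n) \<le> (\<gamma> / \<sigma>) ^ n" for n
      using le[of n] \<gamma> \<sigma> by (simp add: measure_def enn2real_leI)
    moreover have "summable (\<lambda>n. (\<gamma> / \<sigma>) ^ n)"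
      using \<gamma> \<sigma> by (intro summable_geometric) auto
    ultimately show "summable (\<lambda>n. measure M (A n))"
      by (intro summable_comparison_test[OF _ \<open>summable (\<lambda>n. (\<gamma> / \<sigma>) ^ n)\<close>]) auto
  qed
  then show ?thesis
    by eventually_elim (auto simp: A_def not_less elim!: eventually_mono)
qed

text \<open>The first \<open>n\<close> coordinates of the infinite product have the finite product
  as their law, where independence factorises the integral.\<close>

lemma nn_integral_iid_sequence_prod:
  assumes "prob_space P" and f [measurable]: "f \<in> borel_measurable P"
  shows "(\<integral>\<^sup>+ \<omega>. (\<Prod>i<n. f (\<omega> i)) \<partial>iid_sequence P) = (\<integral>\<^sup>+ x. f x \<partial>P) ^ n"
proof -
  interpret prob_space P by fact
  interpret product_prob_space "\<lambda>_::nat. P" UNIV ..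
  have "(\<integral>\<^sup>+ x. f x \<partial>P) ^ n = (\<integral>\<^sup>+ \<omega>. (\<Prod>i<n. f (\<omega> i)) \<partial>PiM {..<n} (\<lambda>_. P))"
    by (subst product_nn_integral_prod) auto
  also have "\<dots> = (\<integral>\<^sup>+ \<omega>. (\<Prod>i<n. f (\<omega> i))
      \<partial>distr (PiM UNIV (\<lambda>_. P)) (PiM {..<n} (\<lambda>_. P)) (\<lambda>\<omega>. restrict \<omega> {..<n}))"
    by (subst distr_PiM_restrict_finite) auto
  also have "\<dots> = (\<integral>\<^sup>+ \<omega>. (\<Prod>i<n. f (\<omega> i)) \<partial>iid_sequence P)"
    unfolding iid_sequence_def by (subst nn_integral_distr) (auto intro!: nn_integral_cong prod.cong)
  finally show ?thesis ..
qed

subsection \<open>Densities and distances in the model\<close>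

context dominated_bayes_model
begin

lemma density_measurable_Pair [measurable (raw)]:
  assumes "f \<in> measurable N \<mu>" "g \<in> measurable N prior"
  shows "(\<lambda>y. p (g y) (f y)) \<in> borel_measurable N"
  using measurable_compose[OF measurable_Pair[OF assms] density_measurable] by simp

lemma density_measurable_section [measurable]:
  "P \<in> model \<Longrightarrow> p P \<in> borel_measurable \<mu>"
  by (rule density_measurable_Pair[where g = "\<lambda>_. P", simplified]) (simp_all add: space_prior)

lemma nn_integral_model:
  assumes P: "P \<in> model" and f: "f \<in> borel_measurable \<mu>"
  shows "(\<integral>\<^sup>+ x. f x \<partial>P) = (\<integral>\<^sup>+ x. ennreal (p P x) * f x \<partial>\<mu>)"
proof -
  have "(\<integral>\<^sup>+ x. f x \<partial>P) = (\<integral>\<^sup>+ x. f x \<partial>density \<mu> (\<lambda>x. ennreal (p P x)))"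
    using model_eq_density[OF P] by metis
  also have "\<dots> = (\<integral>\<^sup>+ x. ennreal (p P x) * f x \<partial>\<mu>)"
    using P f by (intro nn_integral_density) auto
  finally show ?thesis .
qed

lemma nn_integral_density_model: "P \<in> model \<Longrightarrow> (\<integral>\<^sup>+ x. ennreal (p P x) \<partial>\<mu>) = 1"
  using nn_integral_model[of P "\<lambda>_. 1"] prob_space.emeasure_space_1[OF prob_space_model] by simp

lemma integrable_density_model: "P \<in> model \<Longrightarrow> integrable \<mu> (p P)"
  using nn_integral_density_model[of P] density_nonneg[of P]
  by (intro integrableI_nonneg) auto

lemma integral_density_model: "P \<in> model \<Longrightarrow> (\<integral>x. p P x \<partial>\<mu>) = 1"
  using nn_integral_density_model[of P] density_nonneg[of P]
  by (subst integral_eq_nn_integral) auto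

lemma AE_density_pos:
  assumes P: "P \<in> model"
  shows "AE x in P. 0 < p P x"
proof -
  have "AE x in density \<mu> (\<lambda>x. ennreal (p P x)). 0 < p P x"
    using P by (subst AE_density) auto
  then show ?thesis
    using model_eq_density[OF P] by metis
qed

section \<open>The \<open>L^1\<close> distance between model densities\<close>

definition l1_dist :: "'a measure \<Rightarrow> 'a measure \<Rightarrow> real" where
  "l1_dist P Q = (\<integral>x. \<bar>p P x - p Q x\<bar> \<partial>\<mu>)"

lemma integrable_density_diff:
  "P \<in> model \<Longrightarrow> Q \<in> model \<Longrightarrow> integrable \<mu> (\<lambda>x. p P x - p Q x)"
  using integrable_density_model by auto

lemma l1_dist_triangle:
  assumes "P \<in> model" "Q \<in> model" "R \<in> model"
  shows "l1_dist P R \<le> l1_dist P Q + l1_dist Q R"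
proof -
  have "l1_dist P R \<le> (\<integral>x. \<bar>p P x - p Q x\<bar> + \<bar>p Q x - p R x\<bar> \<partial>\<mu>)"
    unfolding l1_dist_def using assms
    by (intro integral_mono) (auto intro!: integrable_density_diff)
  then show ?thesis
    using assms integrable_density_diff by (simp add: l1_dist_def)
qed

lemma l1_dist_commute: "l1_dist P Q = l1_dist Q P"
  by (simp add: l1_dist_def abs_minus_commute)

section \<open>Comparison of the Matusita distance with the \<open>L^1\<close> distance\<close>

context
  fixes r :: real
  assumes r: "1 \<le> r"
begin

lemma matusita_integrable:
  assumes "P \<in> model" "Q \<in> model"
  shows "integrable \<mu> (\<lambda>x. \<bar>p P x powr (1 / r) - p Q x powr (1 / r)\<bar> powr r)"
proof (rule Bochner_Integration.integrable_bound)
  show "integrable \<mu> (\<lambda>x. p P x - p Q x)"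
    using assms by (rule integrable_density_diff)
qed (use assms density_nonneg r in \<open>auto intro!: powr_root_diff_le\<close>)

lemma matusita_dist_powr:
  assumes "P \<in> model" "Q \<in> model"
  shows "matusita_dist \<mu> p r P Q powr r = (\<integral>x. \<bar>p P x powr (1 / r) - p Q x powr (1 / r)\<bar> powr r \<partial>\<mu>)"
  using r by (simp add: matusita_dist_def powr_powr)

lemma matusita_dist_powr_le_l1_dist:
  assumes "P \<in> model" "Q \<in> model"
  shows "matusita_dist \<mu> p r P Q powr r \<le> l1_dist P Q"
  unfolding matusita_dist_powr[OF assms] l1_dist_def
  using assms matusita_integrable integrable_density_diff density_nonneg r
  by (intro integral_mono powr_root_diff_le) auto

text \<open>Integrated form of the converse inequality with relative error
  \<open>\<theta> / 4\<close>: as both densities have mass 1, the error term contributes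
  \<open>\<theta> / 2\<close>.\<close>

lemma l1_dist_small_of_matusita_dist_small:
  assumes "0 < \<theta>"
  obtains \<rho> where "0 < \<rho>"
    "\<And>P Q. P \<in> model \<Longrightarrow> Q \<in> model \<Longrightarrow> matusita_dist \<mu> p r P Q < \<rho> \<Longrightarrow> l1_dist P Q < \<theta>"
proof -
  obtain C where C: "0 \<le> C" "\<And>a b. 0 \<le> a \<Longrightarrow> 0 \<le> b \<Longrightarrow>
      \<bar>a - b\<bar> \<le> \<theta> / 4 * (a + b) + C * \<bar>a powr (1 / r) - b powr (1 / r)\<bar> powr r"
    using diff_le_powr_root_diff[OF r, of "\<theta> / 4"] assms by auto
  \<comment> \<open>Chosen so that \<open>C * \<rho> powr r < \<theta> / 2\<close>; using
    \<open>C + 1\<close> covers \<open>C = 0\<close> and makes the inequality strict.\<close>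
  define \<rho> where "\<rho> = (\<theta> / (2 * (C + 1))) powr (1 / r)"
  show thesis
  proof
    show "0 < \<rho>"
      using assms C by (auto simp: \<rho>_def)
    show "l1_dist P Q < \<theta>" if PQ: "P \<in> model" "Q \<in> model" and d: "matusita_dist \<mu> p r P Q < \<rho>" for P Q
    proof -
      note int = integrable_density_model[OF PQ(1)] integrable_density_model[OF PQ(2)]
        matusita_integrable[OF PQ]
      have "l1_dist P Q \<le> (\<integral>x. \<theta> / 4 * (p P x + p Q x) +
          C * \<bar>p P x powr (1 / r) - p Q x powr (1 / r)\<bar> powr r \<partial>\<mu>)"
        unfolding l1_dist_def using int C(2) density_nonneg PQ
        by (intro integral_mono) (auto intro!: integrable_density_diff)
      also have "\<dots> = \<theta> / 2 + C * matusita_dist \<mu> p r P Q powr r"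
        using int PQ by (simp add: matusita_dist_powr integral_density_model)
      finally have "l1_dist P Q \<le> \<theta> / 2 + C * matusita_dist \<mu> p r P Q powr r" .
      moreover have "matusita_dist \<mu> p r P Q powr r \<le> \<rho> powr r"
        using d r by (intro powr_mono2) (auto simp: matusita_dist_def)
      then have "C * matusita_dist \<mu> p r P Q powr r \<le> C * (\<theta> / (2 * (C + 1)))"
        using C r assms by (intro mult_left_mono) (auto simp: \<rho>_def powr_powr)
      moreover have "C * (\<theta> / (2 * (C + 1))) < \<theta> / 2"
        using C assms by (simp add: field_simps)
      ultimately show ?thesis by linarith
    qed
  qed
qed

lemma matusita_dist_measurable:
  assumes "Q \<in> model"
  shows "(\<lambda>P. matusita_dist \<mu> p r P Q) \<in> borel_measurable prior"
proof -
  have [measurable]: "(\<lambda>z. p Q (snd z)) \<in> borel_measurable (prior \<Otimes>\<^sub>M \<mu>)"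
    using assms by measurable
  show ?thesis
    unfolding matusita_dist_def by measurable
qed

end

section \<open>Moments of the likelihood ratio near \<open>P\<^sub>0\<close>\<close>

text \<open>\<open>mult_sqrt_ratio_le\<close> is integrated with \<open>a\<close> and
  \<open>b\<close> the densities of \<open>P\<^sub>0\<close> and \<open>Q\<close>. The excess over 1
  splits into three parts of size at most \<open>\<eta> / 3\<close>: the relative error,
  \<open>\<kappa>\<close> times the moment bound \<open>M\<close>, and a multiple of the
  \<open>L^1\<close> distance.\<close>

lemma sqrt_ratio_moment_small:
  assumes P\<^sub>0: "P\<^sub>0 \<in> model" and M: "0 \<le> M" and \<eta>: "0 < \<eta>"
  obtains \<theta> where "0 < \<theta>"
    "\<And>Q. Q \<in> model \<Longrightarrow> (\<integral>\<^sup>+ x. ennreal (p P\<^sub>0 x) / ennreal (p Q x) \<partial>P\<^sub>0) \<le> ennreal M \<Longrightarrow>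
      l1_dist P\<^sub>0 Q < \<theta> \<Longrightarrow>
      (\<integral>\<^sup>+ x. ennreal (sqrt (p P\<^sub>0 x)) / ennreal (sqrt (p Q x)) \<partial>P\<^sub>0) \<le> ennreal (1 + \<eta>)"
proof
  \<comment> \<open>First \<open>\<kappa>\<close> is fixed from \<open>M\<close> so that
    \<open>\<kappa> * M \<le> \<eta> / 3\<close>; this determines the factor \<open>c\<close> of the
    \<open>L^1\<close> term, and \<open>\<eta> / (3 * c)\<close> is the admissible distance.\<close>
  define \<kappa> where "\<kappa> = \<eta> / (3 * (M + 1))"
  define c where "c = (1 + 1 / (\<eta> / 3)) / (4 * \<kappa>)"
  have \<kappa>: "0 < \<kappa>"
    using M \<eta> by (simp add: \<kappa>_def)
  then have c: "0 < c"
    using \<eta> by (auto simp: c_def intro!: divide_pos_pos add_pos_pos)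
  show "0 < \<eta> / (3 * c)"
    using \<eta> c by simp
  fix Q assume Q: "Q \<in> model"
    and moment: "(\<integral>\<^sup>+ x. ennreal (p P\<^sub>0 x) / ennreal (p Q x) \<partial>P\<^sub>0) \<le> ennreal M"
    and close: "l1_dist P\<^sub>0 Q < \<eta> / (3 * c)"
  note [measurable] = density_measurable_section[OF P\<^sub>0] density_measurable_section[OF Q]
  have "(\<integral>\<^sup>+ x. ennreal (sqrt (p P\<^sub>0 x)) / ennreal (sqrt (p Q x)) \<partial>P\<^sub>0)
      = (\<integral>\<^sup>+ x. ennreal (p P\<^sub>0 x) * (ennreal (sqrt (p P\<^sub>0 x)) / ennreal (sqrt (p Q x))) \<partial>\<mu>)"
    by (intro nn_integral_model P\<^sub>0) measurable
  also have "\<dots> \<le> (\<integral>\<^sup>+ x. ennreal ((1 + \<eta> / 3) * p P\<^sub>0 x) +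
      ennreal \<kappa> * (ennreal (p P\<^sub>0 x) * (ennreal (p P\<^sub>0 x) / ennreal (p Q x))) +
      ennreal (c * \<bar>p P\<^sub>0 x - p Q x\<bar>) \<partial>\<mu>)"
    unfolding c_def using P\<^sub>0 Q \<eta> \<kappa> density_nonneg by (intro nn_integral_mono mult_sqrt_ratio_le) auto
  also have "\<dots> = (\<integral>\<^sup>+ x. ennreal ((1 + \<eta> / 3) * p P\<^sub>0 x) \<partial>\<mu>) +
      ennreal \<kappa> * (\<integral>\<^sup>+ x. ennreal (p P\<^sub>0 x) * (ennreal (p P\<^sub>0 x) / ennreal (p Q x)) \<partial>\<mu>) +
      (\<integral>\<^sup>+ x. ennreal (c * \<bar>p P\<^sub>0 x - p Q x\<bar>) \<partial>\<mu>)"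
    by (simp add: nn_integral_add nn_integral_cmult)
  also have "(\<integral>\<^sup>+ x. ennreal (p P\<^sub>0 x) * (ennreal (p P\<^sub>0 x) / ennreal (p Q x)) \<partial>\<mu>)
      = (\<integral>\<^sup>+ x. ennreal (p P\<^sub>0 x) / ennreal (p Q x) \<partial>P\<^sub>0)"
    by (intro nn_integral_model[symmetric] P\<^sub>0) measurable
  also have "(\<integral>\<^sup>+ x. ennreal ((1 + \<eta> / 3) * p P\<^sub>0 x) \<partial>\<mu>) = ennreal (1 + \<eta> / 3)"
    using \<eta> P\<^sub>0 density_nonneg integrable_density_model[OF P\<^sub>0] integral_density_model[OF P\<^sub>0]
    by (subst nn_integral_eq_integral) auto
  also have "(\<integral>\<^sup>+ x. ennreal (c * \<bar>p P\<^sub>0 x - p Q x\<bar>) \<partial>\<mu>) = ennreal (c * l1_dist P\<^sub>0 Q)"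
    using c integrable_density_diff[OF P\<^sub>0 Q]
    by (subst nn_integral_eq_integral) (auto simp: l1_dist_def)
  also have "ennreal (1 + \<eta> / 3) + ennreal \<kappa> * (\<integral>\<^sup>+ x. ennreal (p P\<^sub>0 x) / ennreal (p Q x) \<partial>P\<^sub>0) +
      ennreal (c * l1_dist P\<^sub>0 Q) \<le> ennreal (1 + \<eta> / 3) + ennreal \<kappa> * ennreal M + ennreal (\<eta> / 3)"
    using moment close c by (intro add_mono mult_left_mono ennreal_leI) (auto simp: field_simps)
  also have "\<dots> = ennreal (1 + \<eta> / 3 + \<kappa> * M + \<eta> / 3)"
    using \<eta> \<kappa> M by (simp add: ennreal_mult[symmetric] flip: ennreal_plus)
  also have "\<dots> \<le> ennreal (1 + \<eta>)"
    using \<eta> M by (intro ennreal_leI) (simp add: \<kappa>_def field_simps)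
  finally show "(\<integral>\<^sup>+ x. ennreal (sqrt (p P\<^sub>0 x)) / ennreal (sqrt (p Q x)) \<partial>P\<^sub>0) \<le> ennreal (1 + \<eta>)" .
qed

text \<open>The exponent is at least 1, so \<open>u \<le> 1 + u powr \<beta>\<close> reduces the
  first moment to the assumed one; for \<open>r = 1\<close> the essential supremum bound is
  integrated. The right-hand side is large enough for both cases.\<close>

lemma likelihood_ratio_bounded_imp_moment:
  assumes P\<^sub>0: "P\<^sub>0 \<in> model" and Q: "Q \<in> model" and r: "1 \<le> r" and L: "0 < L"
    and bounded: "likelihood_ratio_bounded p r L P\<^sub>0 P\<^sub>0 Q"
  shows "(\<integral>\<^sup>+ x. ennreal (p P\<^sub>0 x) / ennreal (p Q x) \<partial>P\<^sub>0) \<le> ennreal (1 + L + L powr (r / (r - 1)))"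
proof -
  interpret P\<^sub>0: prob_space P\<^sub>0
    using P\<^sub>0 by (rule prob_space_model)
  note [measurable] = density_measurable_section[OF P\<^sub>0] density_measurable_section[OF Q]
  note [measurable_cong] = sets_model[OF P\<^sub>0]
  show ?thesis
  proof (cases "r = 1")
    case True
    then have "AE x in P\<^sub>0. ennreal (p P\<^sub>0 x) / ennreal (p Q x) \<le> ennreal L"
      using bounded esssup_AE[of "\<lambda>x. ennreal (p P\<^sub>0 x) / ennreal (p Q x)" P\<^sub>0]
      by (auto simp: likelihood_ratio_bounded_def elim!: eventually_mono)
    then have "(\<integral>\<^sup>+ x. ennreal (p P\<^sub>0 x) / ennreal (p Q x) \<partial>P\<^sub>0) \<le> (\<integral>\<^sup>+ x. ennreal L \<partial>P\<^sub>0)"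
      by (rule nn_integral_mono_AE)
    \<comment> \<open>At \<open>r = 1\<close> the exponent \<open>r / (r - 1)\<close> takes the
      default value 0; only the nonnegativity of that summand matters here.\<close>
    also have "\<dots> \<le> ennreal (1 + L + L powr (r / (r - 1)))"
      by (simp add: P\<^sub>0.emeasure_space_1 ennreal_leI)
    finally show ?thesis .
  next
    case False
    define s where "s = r / (r - 1)"
    define \<beta> where "\<beta> = max (s / r) 1"
    \<comment> \<open>The integrand of the moment at \<open>P = P\<^sub>0\<close>; it is infinite
      where the density of \<open>Q\<close> vanishes and that of \<open>P\<^sub>0\<close> does not,
      which settles that case of the pointwise bound.\<close>
    define F where "F x = (if p Q x = 0 then \<infinity> else ennreal ((p P\<^sub>0 x / p Q x) powr \<beta>)) *
      indicator {x. 0 < p P\<^sub>0 x \<and> 0 < p P\<^sub>0 x} x" for x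
    have [measurable]: "F \<in> borel_measurable \<mu>"
      unfolding F_def by measurable
    have F: "(\<integral>\<^sup>+ x. F x \<partial>P\<^sub>0) \<le> ennreal (L powr s)"
      using False bounded
      unfolding likelihood_ratio_bounded_def likelihood_ratio_moment_def Let_def F_def s_def \<beta>_def
      by simp
    have "AE x in P\<^sub>0. ennreal (p P\<^sub>0 x) / ennreal (p Q x) \<le> 1 + F x"
      using AE_density_pos[OF P\<^sub>0] AE_space
    proof eventually_elim
      case (elim x)
      have "x \<in> space \<mu>"
        using elim sets_eq_imp_space_eq[OF sets_model[OF P\<^sub>0]] by simp
      then have q: "0 \<le> p Q x"
        using density_nonneg[OF Q] by simp
      show ?case
      proof (cases "p Q x = 0")
        case True
        then show ?thesis
          using elim by (simp add: F_def)
      next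
        case False
        define u where "u = p P\<^sub>0 x / p Q x"
        have u: "0 < u"
          using False q elim by (simp add: u_def)
        have "u \<le> 1 + u powr \<beta>"
        proof (cases "u \<le> 1")
          case False
          then have "u powr 1 \<le> u powr \<beta>"
            by (intro powr_mono) (auto simp: \<beta>_def)
          then show ?thesis
            using u by simp
        qed (simp add: add_increasing2)
        then have "ennreal u \<le> 1 + ennreal (u powr \<beta>)"
          by (metis ennreal_1 ennreal_leI ennreal_plus powr_ge_zero zero_le_one)
        then show ?thesis
          using False q elim by (simp add: F_def u_def divide_ennreal)
      qed
    qed
    then have "(\<integral>\<^sup>+ x. ennreal (p P\<^sub>0 x) / ennreal (p Q x) \<partial>P\<^sub>0) \<le> (\<integral>\<^sup>+ x. 1 + F x \<partial>P\<^sub>0)"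
      by (rule nn_integral_mono_AE)
    also have "\<dots> = 1 + (\<integral>\<^sup>+ x. F x \<partial>P\<^sub>0)"
      by (subst nn_integral_add) (auto simp: P\<^sub>0.emeasure_space_1)
    also have "\<dots> \<le> 1 + ennreal (L powr s)"
      using F by (rule add_left_mono)
    also have "\<dots> = ennreal (1 + L powr s)"
      by (simp add: ennreal_plus flip: ennreal_1)
    also have "\<dots> \<le> ennreal (1 + L + L powr s)"
      using L by (intro ennreal_leI) simp
    finally show ?thesis
      by (simp add: s_def)
  qed
qed

subsection \<open>Posterior mass of a set separated by a test\<close>

lemma mixture_likelihood_measurable:
  assumes P\<^sub>0: "P\<^sub>0 \<in> model"
    and F: "(\<lambda>z. F (snd z) (fst z)) \<in> borel_measurable (\<mu> \<Otimes>\<^sub>M prior)"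
    and V: "V \<in> sets prior"
  shows "(\<lambda>(\<omega>, P). (\<Prod>i<n. F P (\<omega> i)) * indicator V P :: ennreal)
      \<in> borel_measurable (iid_sequence P\<^sub>0 \<Otimes>\<^sub>M prior)"
proof -
  note [measurable] = V
  have [measurable_cong]: "sets (iid_sequence P\<^sub>0) = sets (PiM UNIV (\<lambda>_. \<mu>))"
    unfolding iid_sequence_def using sets_model[OF P\<^sub>0] by (intro sets_PiM_cong) auto
  have [measurable]: "(\<lambda>z. F (snd z) (fst z i)) \<in> borel_measurable (iid_sequence P\<^sub>0 \<Otimes>\<^sub>M prior)" for i
    using measurable_compose[of "\<lambda>z. (fst z i, snd z)" "iid_sequence P\<^sub>0 \<Otimes>\<^sub>M prior" "\<mu> \<Otimes>\<^sub>M prior", OF _ F]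
    by simp
  show ?thesis
    unfolding case_prod_beta' by measurable
qed

text \<open>Tonelli's theorem exchanges sample and prior. For fixed \<open>P\<close> the inner
  integral is the \<open>n\<close>-th power of a one-observation integral, and the prior has mass 1.
  It serves numerator and denominator alike.\<close>

lemma nn_integral_mixture_likelihood_le:
  assumes P\<^sub>0: "P\<^sub>0 \<in> model"
    and F: "(\<lambda>z. F (snd z) (fst z)) \<in> borel_measurable (\<mu> \<Otimes>\<^sub>M prior)"
    and V: "V \<in> sets prior"
    and K: "0 \<le> K" "\<And>P. P \<in> V \<Longrightarrow> (\<integral>\<^sup>+ x. F P x \<partial>P\<^sub>0) \<le> ennreal K"
  shows "(\<integral>\<^sup>+ \<omega>. (\<integral>\<^sup>+ P \<in> V. (\<Prod>i<n. F P (\<omega> i)) \<partial>prior) \<partial>iid_sequence P\<^sub>0) \<le> ennreal (K ^ n)"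
proof -
  interpret P\<^sub>0: prob_space P\<^sub>0
    using P\<^sub>0 by (rule prob_space_model)
  interpret seq: product_prob_space "\<lambda>_::nat. P\<^sub>0" UNIV ..
  interpret seq: prob_space "iid_sequence P\<^sub>0"
    unfolding iid_sequence_def by (rule seq.prob_space_axioms)
  interpret pair_sigma_finite "iid_sequence P\<^sub>0" prior ..
  have [measurable]: "F P \<in> borel_measurable P\<^sub>0" if "P \<in> space prior" for P
    using measurable_compose[OF measurable_Pair2' F, of P] that sets_model[OF P\<^sub>0]
    by (simp cong: measurable_cong_sets)
  have V_space: "P \<in> space prior" if "P \<in> V" for P
    using that sets.sets_into_space[OF V] by auto
  have "(\<integral>\<^sup>+ \<omega>. (\<integral>\<^sup>+ P \<in> V. (\<Prod>i<n. F P (\<omega> i)) \<partial>prior) \<partial>iid_sequence P\<^sub>0)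
      = (\<integral>\<^sup>+ P. (\<integral>\<^sup>+ \<omega>. (\<Prod>i<n. F P (\<omega> i)) * indicator V P \<partial>iid_sequence P\<^sub>0) \<partial>prior)"
    using Fubini'[OF mixture_likelihood_measurable[OF P\<^sub>0 F V]] by simp
  also have "\<dots> \<le> (\<integral>\<^sup>+ P. ennreal (K ^ n) \<partial>prior)"
  proof (rule nn_integral_mono)
    fix P assume "P \<in> space prior"
    show "(\<integral>\<^sup>+ \<omega>. (\<Prod>i<n. F P (\<omega> i)) * indicator V P \<partial>iid_sequence P\<^sub>0) \<le> ennreal (K ^ n)"
    proof (cases "P \<in> V")
      case True
      then have "(\<integral>\<^sup>+ \<omega>. (\<Prod>i<n. F P (\<omega> i)) * indicator V P \<partial>iid_sequence P\<^sub>0) = (\<integral>\<^sup>+ x. F P x \<partial>P\<^sub>0) ^ n"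
        using V_space by (simp add: nn_integral_iid_sequence_prod P\<^sub>0.prob_space_axioms)
      also have "\<dots> \<le> ennreal K ^ n"
        using K True by (intro power_mono) auto
      finally show ?thesis
        using K by (simp add: ennreal_power)
    qed simp
  qed
  also have "\<dots> = ennreal (K ^ n)"
    by (simp add: prior.emeasure_space_1)
  finally show ?thesis .
qed

text \<open>Relative to the likelihood of \<open>P\<^sub>0\<close>, the numerator is eventually at
  most \<open>\<sigma> ^ (2 * n)\<close> and the denominator at least a constant times
  \<open>\<tau> ^ (2 * n)\<close>, with \<open>\<sigma> < \<tau>\<close>. The neighbourhood is
  chosen after these rates, hence the quantification over all \<open>\<eta>\<close>.\<close>

lemma posterior_tendsto_0_of_test:
  assumes P\<^sub>0: "P\<^sub>0 \<in> model" and V: "V \<in> sets prior"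
    and g [measurable]: "g \<in> borel_measurable \<mu>" and g_pos: "\<And>x. x \<in> space \<mu> \<Longrightarrow> 0 < g x"
    and \<gamma>: "0 \<le> \<gamma>" "\<gamma> < 1"
    and test_V: "\<And>P. P \<in> V \<Longrightarrow> (\<integral>\<^sup>+ x. ennreal (g x) \<partial>P) \<le> ennreal \<gamma>"
    and test_P\<^sub>0: "(\<integral>\<^sup>+ x. ennreal (1 / g x) \<partial>P\<^sub>0) \<le> ennreal \<gamma>"
    and neighbourhood: "\<And>\<eta>. 0 < \<eta> \<Longrightarrow> \<exists>B\<in>sets prior. 0 < measure prior B \<and>
      (\<forall>Q\<in>B. (\<integral>\<^sup>+ x. ennreal (sqrt (p P\<^sub>0 x)) / ennreal (sqrt (p Q x)) \<partial>P\<^sub>0) \<le> ennreal (1 + \<eta>))"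
  shows "AE \<omega> in iid_sequence P\<^sub>0. (\<lambda>n. posterior p prior n \<omega> V) \<longlonglongrightarrow> 0"
proof -
  interpret P\<^sub>0: prob_space P\<^sub>0
    using P\<^sub>0 by (rule prob_space_model)
  note [measurable] = density_measurable_section[OF P\<^sub>0] V
  note [measurable_cong] = sets_model[OF P\<^sub>0]
  have space_P\<^sub>0: "space P\<^sub>0 = space \<mu>"
    using sets_model[OF P\<^sub>0] by (rule sets_eq_imp_space_eq)
  have V_model: "P \<in> model" if "P \<in> V" for P
    using that sets.sets_into_space[OF V] space_prior by auto
  \<comment> \<open>The gap between \<open>\<gamma>\<close> and \<open>\<sigma>\<close> pays for
    Borel-Cantelli, the gap between \<open>\<sigma>\<close> and \<open>\<tau>\<close> gives the
    final decay, and \<open>\<sigma>'\<close> lies between 1 and \<open>1 / \<tau>\<close>, so that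
    \<open>\<tau> * \<sigma>' < 1\<close>.\<close>
  define \<sigma> where "\<sigma> = (1 + \<gamma>) / 2"
  define \<tau> where "\<tau> = (1 + \<sigma>) / 2"
  define \<sigma>' where "\<sigma>' = (1 + 1 / \<tau>) / 2"
  have \<sigma>: "\<gamma> < \<sigma>" "0 < \<sigma>" "\<sigma> < 1"
    using \<gamma> by (auto simp: \<sigma>_def)
  have \<tau>: "\<sigma> < \<tau>" "0 < \<tau>" "\<tau> < 1"
    using \<sigma> by (auto simp: \<tau>_def)
  have \<sigma>': "1 < \<sigma>'" "\<tau> * \<sigma>' < 1"
    using \<tau> by (auto simp: \<sigma>'_def field_simps)
  obtain B where B [measurable]: "B \<in> sets prior" and B_pos: "0 < measure prior B"
    and ratio_B: "\<And>Q. Q \<in> B \<Longrightarrow> (\<integral>\<^sup>+ x. ennreal (sqrt (p P\<^sub>0 x)) / ennreal (sqrt (p Q x)) \<partial>P\<^sub>0)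
      \<le> ennreal (1 + (\<sigma>' - 1) / 2)"
    using neighbourhood[of "(\<sigma>' - 1) / 2"] \<sigma>' by auto
  have B_model: "P \<in> model" if "P \<in> B" for P
    using that sets.sets_into_space[OF B] space_prior by auto
  \<comment> \<open>\<open>F\<close> is the likelihood ratio weighted by the test, whose mean under
    \<open>P\<^sub>0\<close> is at most the mean of \<open>g\<close> under \<open>P\<close>;
    \<open>H\<close> is the inverse square root of the ratio, whose mean is near 1 on
    \<open>B\<close>.\<close>
  define F where "F P x = ennreal (g x) * (ennreal (p P x) / ennreal (p P\<^sub>0 x))" for P x
  define H where "H Q x = ennreal (sqrt (p P\<^sub>0 x)) / ennreal (sqrt (p Q x))" for Q x
  have F: "(\<lambda>z. F (snd z) (fst z)) \<in> borel_measurable (\<mu> \<Otimes>\<^sub>M prior)"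
    unfolding F_def by measurable
  have H: "(\<lambda>z. H (snd z) (fst z)) \<in> borel_measurable (\<mu> \<Otimes>\<^sub>M prior)"
    unfolding H_def by measurable
  have test_F: "(\<integral>\<^sup>+ x. F P x \<partial>P\<^sub>0) \<le> ennreal \<gamma>" if "P \<in> V" for P
  proof -
    have [measurable]: "p P \<in> borel_measurable \<mu>"
      using V_model[OF that] by (rule density_measurable_section)
    have "(\<integral>\<^sup>+ x. F P x \<partial>P\<^sub>0) = (\<integral>\<^sup>+ x. ennreal (p P\<^sub>0 x) * F P x \<partial>\<mu>)"
      by (intro nn_integral_model P\<^sub>0) (simp add: F_def)
    \<comment> \<open>Only an inequality: where the density of \<open>P\<^sub>0\<close> vanishes,
      the left integrand is 0 although \<open>P\<close> may have mass there.\<close>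
    also have "\<dots> \<le> (\<integral>\<^sup>+ x. ennreal (p P x) * ennreal (g x) \<partial>\<mu>)"
    proof (rule nn_integral_mono)
      fix x assume x: "x \<in> space \<mu>"
      have "0 < p P\<^sub>0 x \<or> p P\<^sub>0 x = 0"
        using density_nonneg[OF P\<^sub>0 x] by auto
      then show "ennreal (p P\<^sub>0 x) * F P x \<le> ennreal (p P x) * ennreal (g x)"
        using density_nonneg[OF V_model[OF that] x] g_pos[OF x]
        by (auto simp: F_def divide_ennreal ennreal_mult[symmetric] mult.commute)
    qed
    also have "\<dots> = (\<integral>\<^sup>+ x. ennreal (g x) \<partial>P)"
      by (intro nn_integral_model[symmetric] V_model that) simp
    finally show ?thesis
      using test_V[OF that] by simp
  qed
  have sections: "(\<lambda>\<omega>. \<integral>\<^sup>+ P \<in> W. (\<Prod>i<n. G P (\<omega> i)) \<partial>prior) \<in> borel_measurable (iid_sequence P\<^sub>0)"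
    if "(\<lambda>z. G (snd z) (fst z)) \<in> borel_measurable (\<mu> \<Otimes>\<^sub>M prior)" "W \<in> sets prior" for G W and n :: nat
    using prior.borel_measurable_nn_integral[OF mixture_likelihood_measurable[OF P\<^sub>0 that]] by simp
  have "AE \<omega> in iid_sequence P\<^sub>0. eventually (\<lambda>n. (\<integral>\<^sup>+ P \<in> V. (\<Prod>i<n. F P (\<omega> i)) \<partial>prior) \<le> ennreal (\<sigma> ^ n)) sequentially"
    by (rule AE_eventually_le_power[OF sections[OF F V] nn_integral_mixture_likelihood_le[OF P\<^sub>0 F V \<gamma>(1) test_F] \<gamma>(1) \<sigma>(1)])
  \<comment> \<open>Both rates, \<open>1 + (\<sigma>' - 1) / 2\<close> and \<open>\<sigma>'\<close>,
    exceed 1 here, so this limits growth instead of giving decay.\<close>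
  moreover have "AE \<omega> in iid_sequence P\<^sub>0. eventually (\<lambda>n. (\<integral>\<^sup>+ P \<in> B. (\<Prod>i<n. H P (\<omega> i)) \<partial>prior) \<le> ennreal (\<sigma>' ^ n)) sequentially"
    by (rule AE_eventually_le_power[OF sections[OF H B] nn_integral_mixture_likelihood_le[OF P\<^sub>0 H B, of "1 + (\<sigma>' - 1) / 2"]])
      (use \<sigma>' ratio_B in \<open>auto simp: H_def field_simps\<close>)
  moreover have "AE \<omega> in iid_sequence P\<^sub>0. eventually (\<lambda>n. (\<Prod>i<n. ennreal (1 / g (\<omega> i))) \<le> ennreal (\<sigma> ^ n)) sequentially"
  proof (rule AE_eventually_le_power[OF _ _ \<gamma>(1) \<sigma>(1)])
    show "(\<lambda>\<omega>. \<Prod>i<n. ennreal (1 / g (\<omega> i))) \<in> borel_measurable (iid_sequence P\<^sub>0)" for n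
      unfolding iid_sequence_def by measurable
    show "(\<integral>\<^sup>+ \<omega>. (\<Prod>i<n. ennreal (1 / g (\<omega> i))) \<partial>iid_sequence P\<^sub>0) \<le> ennreal (\<gamma> ^ n)" for n
      using power_mono[OF test_P\<^sub>0, of n] \<gamma>
      by (subst nn_integral_iid_sequence_prod[of P\<^sub>0 "\<lambda>x. ennreal (1 / g x)"])
        (auto simp: P\<^sub>0.prob_space_axioms ennreal_power)
  qed
  moreover have "AE \<omega> in iid_sequence P\<^sub>0. \<forall>i. 0 < p P\<^sub>0 (\<omega> i)"
    unfolding iid_sequence_def AE_all_countable
    using AE_density_pos[OF P\<^sub>0] by (auto intro!: AE_PiM_component P\<^sub>0.prob_space_axioms)
  ultimately show ?thesis
    using AE_space
  proof eventually_elim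
    case (elim \<omega>)
    have \<omega>: "\<omega> i \<in> space \<mu>" for i
      using elim(5) space_P\<^sub>0 by (auto simp: iid_sequence_def space_PiM)
    define b where "b = measure prior B"
    \<comment> \<open>Eventually the \<open>H\<close> term in the lower bound of the denominator
      takes up less than half of the prior mass \<open>b\<close> of \<open>B\<close>.\<close>
    have "(\<lambda>n. (\<tau> * \<sigma>') ^ n) \<longlonglongrightarrow> 0"
      using \<tau> \<sigma>' by (intro LIMSEQ_power_zero) auto
    then have "eventually (\<lambda>n. (\<tau> * \<sigma>') ^ n < b / 2) sequentially"
      using B_pos by (intro order_tendstoD) (auto simp: b_def)
    with elim(1-3) have "eventually (\<lambda>n. posterior p prior n \<omega> V \<le> ennreal (2 / b * ((\<sigma> / \<tau>)\<^sup>2) ^ n)) sequentially"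
    proof eventually_elim
      case (elim n)
      note bound_F = elim(1) and bound_H = elim(2) and bound_g = elim(3) and small = elim(4)
      have [measurable]: "(\<lambda>P. p P (\<omega> i)) \<in> borel_measurable prior" for i
        using \<omega> by (intro density_measurable_Pair) auto
      define Z where "Z = (\<Prod>i<n. p P\<^sub>0 (\<omega> i))"
      define s where "s = \<tau> ^ n"
      have Z: "0 < Z"
        unfolding Z_def using \<open>\<forall>i. 0 < p P\<^sub>0 (\<omega> i)\<close> by (intro prod_pos) auto
      have s: "0 < s"
        using \<tau> by (simp add: s_def)
      \<comment> \<open>Each factor is multiplied and divided by \<open>g\<close> and by the density
        of \<open>P\<^sub>0\<close>, both positive at the observations. The weight and the mixture
        then contribute one \<open>\<sigma> ^ n\<close> each.\<close>
      have "(\<integral>\<^sup>+ P \<in> V. (\<Prod>i<n. ennreal (p P (\<omega> i))) \<partial>prior)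
        = (\<integral>\<^sup>+ P. (ennreal Z * (\<Prod>i<n. ennreal (1 / g (\<omega> i)))) * ((\<Prod>i<n. F P (\<omega> i)) * indicator V P) \<partial>prior)"
      proof (rule nn_integral_cong)
        fix P assume "P \<in> space prior"
        then have "ennreal (p P (\<omega> i)) = ennreal (p P\<^sub>0 (\<omega> i)) * ennreal (1 / g (\<omega> i)) * F P (\<omega> i)" for i
          using \<omega>[of i] g_pos[of "\<omega> i"] density_nonneg[of P "\<omega> i"] \<open>\<forall>i. 0 < p P\<^sub>0 (\<omega> i)\<close>[rule_format, of i]
          by (simp add: F_def space_prior divide_ennreal ennreal_mult[symmetric])
        then have "(\<Prod>i<n. ennreal (p P (\<omega> i)))
            = (\<Prod>i<n. ennreal (p P\<^sub>0 (\<omega> i)) * ennreal (1 / g (\<omega> i)) * F P (\<omega> i))"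
          by simp
        also have "\<dots> = ennreal Z * (\<Prod>i<n. ennreal (1 / g (\<omega> i))) * (\<Prod>i<n. F P (\<omega> i))"
          using density_nonneg[OF P\<^sub>0 \<omega>] by (simp add: prod.distrib Z_def prod_ennreal)
        finally show "(\<Prod>i<n. ennreal (p P (\<omega> i))) * indicator V P =
            (ennreal Z * (\<Prod>i<n. ennreal (1 / g (\<omega> i)))) * ((\<Prod>i<n. F P (\<omega> i)) * indicator V P)"
          by (simp add: mult.assoc)
      qed
      also have "\<dots> = ennreal Z * (\<Prod>i<n. ennreal (1 / g (\<omega> i))) * (\<integral>\<^sup>+ P \<in> V. (\<Prod>i<n. F P (\<omega> i)) \<partial>prior)"
        by (intro nn_integral_cmult) (simp add: F_def)
      also have "\<dots> \<le> ennreal Z * ennreal (\<sigma> ^ n) * ennreal (\<sigma> ^ n)"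
        by (intro mult_mono bound_F bound_g) auto
      also have "\<dots> = ennreal (Z * (\<sigma>\<^sup>2) ^ n)"
        using Z \<sigma> by (simp add: ennreal_mult[symmetric] power2_eq_square power_mult_distrib)
      finally have numerator: "(\<integral>\<^sup>+ P \<in> V. (\<Prod>i<n. ennreal (p P (\<omega> i))) \<partial>prior) \<le> ennreal (Z * (\<sigma>\<^sup>2) ^ n)" .

      let ?D = "\<integral>\<^sup>+ P. (\<Prod>i<n. ennreal (p P (\<omega> i))) \<partial>prior"
      (* With y the likelihood ratio of Q to P0, the product of the H Q is 1 / sqrt y,
         so one summand is at least 1 according as y < s^2 or not. *)
      have pointwise: "1 \<le> ennreal s * (\<Prod>i<n. H Q (\<omega> i)) + ennreal (1 / (Z * s\<^sup>2)) * (\<Prod>i<n. ennreal (p Q (\<omega> i)))"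
        if Q: "Q \<in> model" for Q
      proof -
        define Y where "Y = (\<Prod>i<n. p Q (\<omega> i))"
        have q: "0 \<le> p Q (\<omega> i)" and p0: "0 < p P\<^sub>0 (\<omega> i)" for i
          using density_nonneg[OF Q \<omega>] \<open>\<forall>i. 0 < p P\<^sub>0 (\<omega> i)\<close> by auto
        have Y: "0 \<le> Y" "(\<Prod>i<n. ennreal (p Q (\<omega> i))) = ennreal Y"
          using q by (auto simp: Y_def prod_ennreal intro!: prod_nonneg)
        show ?thesis
        proof (cases "Z * s\<^sup>2 \<le> Y")
          case True
          then have "1 \<le> 1 / (Z * s\<^sup>2) * Y"
            using Z s by (simp add: field_simps)
          then have "1 \<le> ennreal (1 / (Z * s\<^sup>2)) * ennreal Y"
            using Z s Y by (metis ennreal_1 ennreal_leI ennreal_mult' zero_le_divide_1_iff zero_le_mult_iff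
                zero_le_power2 less_imp_le)
          then show ?thesis
            by (simp add: Y add_increasing)
        next
          case False
          have "1 \<le> ennreal s * (\<Prod>i<n. H Q (\<omega> i))"
          \<comment> \<open>If an observation has density 0 under \<open>Q\<close>, its
            \<open>H\<close> factor is infinite; no factor is 0, so the whole product is
            infinite.\<close>
          proof (cases "\<exists>i<n. p Q (\<omega> i) = 0")
            case True
            then obtain i where "i < n" "p Q (\<omega> i) = 0"
              by blast
            moreover from this have "H Q (\<omega> i) = top"
              using p0[of i] by (simp add: H_def)
            moreover have "H Q (\<omega> i) \<noteq> 0" for i
              using p0[of i] by (simp add: H_def)
            ultimately have "(\<Prod>i<n. H Q (\<omega> i)) = top"
              by (subst ennreal_prod_eq_top) auto
            then show ?thesis
              using s by (simp add: ennreal_mult_top)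
          next
            case no_zero: False
            then have q_pos: "0 < p Q (\<omega> i)" if "i < n" for i
              using that q[of i] by (auto simp: less_le)
            have Y_pos: "0 < Y"
              unfolding Y_def using q_pos by (intro prod_pos) auto
            have "(\<Prod>i<n. H Q (\<omega> i)) = (\<Prod>i<n. ennreal (sqrt (p P\<^sub>0 (\<omega> i) / p Q (\<omega> i))))"
              using q_pos p0 by (intro prod.cong) (auto simp: H_def divide_ennreal real_sqrt_divide less_imp_le)
            also have "\<dots> = ennreal (\<Prod>i<n. sqrt (p P\<^sub>0 (\<omega> i) / p Q (\<omega> i)))"
              using q p0 by (intro prod_ennreal) (auto simp: less_imp_le)
            also have "(\<Prod>i<n. sqrt (p P\<^sub>0 (\<omega> i) / p Q (\<omega> i))) = sqrt (Z / Y)"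
              unfolding Z_def Y_def prod_dividef[symmetric] by (induction n) (simp_all add: real_sqrt_mult del: times_divide_eq_right)
            finally have prod_H: "(\<Prod>i<n. H Q (\<omega> i)) = ennreal (sqrt (Z / Y))" .
            have "1 \<le> Z / Y * s\<^sup>2"
              using False Y_pos by (simp add: field_simps)
            then have "sqrt 1 \<le> sqrt (Z / Y * s\<^sup>2)"
              by (rule real_sqrt_le_mono)
            then have "1 \<le> s * sqrt (Z / Y)"
              using s by (simp only: real_sqrt_mult) (simp add: mult.commute)
            then show ?thesis
              unfolding prod_H using s Z Y_pos by (simp add: ennreal_mult[symmetric])
          qed
          then show ?thesis
            by (simp add: add_increasing2)
        qed
      qed
      \<comment> \<open>The pointwise alternative is integrated over \<open>B\<close>, enlarging the
        domain of the likelihood term to the whole model. As the \<open>H\<close> term is at most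
        \<open>b / 2\<close>, the likelihood term must supply the other half.\<close>
      have "ennreal b = (\<integral>\<^sup>+ Q. 1 * indicator B Q \<partial>prior)"
        by (simp add: b_def prior.emeasure_eq_measure)
      also have "\<dots> \<le> (\<integral>\<^sup>+ Q. ennreal s * ((\<Prod>i<n. H Q (\<omega> i)) * indicator B Q) +
          ennreal (1 / (Z * s\<^sup>2)) * (\<Prod>i<n. ennreal (p Q (\<omega> i))) \<partial>prior)"
        using pointwise B_model by (intro nn_integral_mono) (auto simp: indicator_def)
      also have "\<dots> = ennreal s * (\<integral>\<^sup>+ Q \<in> B. (\<Prod>i<n. H Q (\<omega> i)) \<partial>prior) + ennreal (1 / (Z * s\<^sup>2)) * ?D"
        by (simp add: nn_integral_add nn_integral_cmult H_def)
      also have "\<dots> \<le> ennreal s * ennreal (\<sigma>' ^ n) + ennreal (1 / (Z * s\<^sup>2)) * ?D"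
        by (intro add_mono mult_left_mono bound_H) auto
      also have "ennreal s * ennreal (\<sigma>' ^ n) = ennreal ((\<tau> * \<sigma>') ^ n)"
        using s \<sigma>' by (simp add: s_def ennreal_mult[symmetric] power_mult_distrib)
      also have "\<dots> \<le> ennreal (b / 2)"
        using small by (intro ennreal_leI) simp
      finally have "ennreal b \<le> ennreal (b / 2) + ennreal (1 / (Z * s\<^sup>2)) * ?D"
        by (simp add: add_right_mono)
      then have denominator: "ennreal (Z * s\<^sup>2 * b / 2) \<le> ?D"
      \<comment> \<open>A finite denominator allows cancelling \<open>b / 2\<close> in the reals; an
        infinite one satisfies the bound trivially.\<close>
      proof (cases ?D)
        case (real d)
        then have "b \<le> b / 2 + 1 / (Z * s\<^sup>2) * d"
          using \<open>ennreal b \<le> ennreal (b / 2) + ennreal (1 / (Z * s\<^sup>2)) * ?D\<close> Z s B_pos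
          by (simp add: b_def ennreal_mult[symmetric] ennreal_plus[symmetric] del: ennreal_plus)
        then have "Z * s\<^sup>2 * b / 2 \<le> d"
          using Z s by (simp add: field_simps)
        then show ?thesis
          using real by (simp add: ennreal_leI)
      qed simp
      have "posterior p prior n \<omega> V \<le> ennreal (Z * (\<sigma>\<^sup>2) ^ n) / ennreal (Z * s\<^sup>2 * b / 2)"
        unfolding posterior_def using numerator denominator by (rule divide_mono_ennreal)
      also have "\<dots> = ennreal (Z * (\<sigma>\<^sup>2) ^ n / (Z * s\<^sup>2 * b / 2))"
        using Z s B_pos \<sigma> by (intro divide_ennreal) (auto simp: b_def)
      also have "Z * (\<sigma>\<^sup>2) ^ n / (Z * s\<^sup>2 * b / 2) = 2 / b * ((\<sigma> / \<tau>)\<^sup>2) ^ n"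
        using Z \<tau> by (simp add: s_def field_simps) (simp add: power_mult[symmetric] mult.commute)
      finally show ?case .
    qed
    moreover have "(\<lambda>n. ennreal (2 / b * ((\<sigma> / \<tau>)\<^sup>2) ^ n)) \<longlonglongrightarrow> ennreal (2 / b * 0)"
      using \<sigma> \<tau> by (intro tendsto_ennrealI tendsto_mult tendsto_const LIMSEQ_power_zero)
        (auto simp: power_less_one_iff abs_square_less_1)
    ultimately show "(\<lambda>n. posterior p prior n \<omega> V) \<longlonglongrightarrow> 0"
      by (intro tendsto_sandwich[of "\<lambda>_. 0" "\<lambda>n. posterior p prior n \<omega> V" sequentially
            "\<lambda>n. ennreal (2 / b * ((\<sigma> / \<tau>)\<^sup>2) ^ n)"]) auto
  qed
qed

subsection \<open>Tests for total variation balls\<close>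

lemma measure_eq_integral_density:
  assumes P: "P \<in> model" and A [measurable]: "A \<in> sets \<mu>"
  shows "measure P A = (\<integral>x. p P x * indicator A x \<partial>\<mu>)"
    and "integrable \<mu> (\<lambda>x. p P x * indicator A x)"
proof -
  show "integrable \<mu> (\<lambda>x. p P x * indicator A x)"
    using A integrable_density_model[OF P] by (rule integrable_real_mult_indicator)
  have "measure P A = (\<integral>x. indicator A x \<partial>P)"
    using A sets_model[OF P] by simp
  also have "\<dots> = (\<integral>x. indicator A x \<partial>density \<mu> (\<lambda>x. ennreal (p P x)))"
    using model_eq_density[OF P] by metis
  also have "\<dots> = (\<integral>x. p P x * indicator A x \<partial>\<mu>)"
    using P density_nonneg[OF P] by (subst integral_real_density) auto
  finally show "measure P A = (\<integral>x. p P x * indicator A x \<partial>\<mu>)" .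
qed

lemma measure_diff_le_l1_dist:
  assumes "P \<in> model" "Q \<in> model" "A \<in> sets \<mu>"
  shows "measure P A - measure Q A \<le> l1_dist P Q"
proof -
  note int = measure_eq_integral_density[OF assms(1,3)] measure_eq_integral_density[OF assms(2,3)]
  have "measure P A - measure Q A = (\<integral>x. p P x * indicator A x - p Q x * indicator A x \<partial>\<mu>)"
    using int by simp
  also have "\<dots> \<le> l1_dist P Q"
    unfolding l1_dist_def using int integrable_density_diff assms
    by (intro integral_mono) (auto simp: indicator_def)
  finally show ?thesis .
qed

text \<open>Scheffe's identity: on the set where the first density is larger the positive part of
  the difference is concentrated, and positive and negative parts have equal integrals because both
  masses are 1.\<close>

lemma l1_dist_eq_measure_diff:
  assumes P: "P \<in> model" and Q: "Q \<in> model"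
  obtains A where "A \<in> sets \<mu>" "l1_dist P Q = 2 * (measure P A - measure Q A)"
proof
  note [measurable] = density_measurable_section[OF P] density_measurable_section[OF Q]
  define A where "A = {x \<in> space \<mu>. p Q x < p P x}"
  show A: "A \<in> sets \<mu>"
    unfolding A_def by measurable
  note int = measure_eq_integral_density[OF P A] measure_eq_integral_density[OF Q A]
    integrable_density_model[OF P] integrable_density_model[OF Q]
  have "l1_dist P Q = (\<integral>x. 2 * (p P x * indicator A x - p Q x * indicator A x) - (p P x - p Q x) \<partial>\<mu>)"
    unfolding l1_dist_def by (intro Bochner_Integration.integral_cong) (auto simp: A_def indicator_def)
  also have "\<dots> = 2 * (measure P A - measure Q A)"
    using int P Q by (simp add: integral_density_model)
  finally show "l1_dist P Q = 2 * (measure P A - measure Q A)" .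
qed

text \<open>Take \<open>g = 1 - \<Delta>\<close> with \<open>\<Delta>\<close> a small multiple of
  the indicator of \<open>A\<close> minus the threshold
  \<open>t = measure P\<^sub>0 A + \<kappa>\<close>. The mean of \<open>\<Delta>\<close> is at least
  \<open>\<kappa>\<^sup>2 / 16\<close> on \<open>V\<close> and exactly minus that under
  \<open>P\<^sub>0\<close>. The second-order error of \<open>1 / g\<close> is at most
  \<open>\<kappa>\<^sup>2 / 32\<close>, half the gain.\<close>

lemma test_of_separation:
  assumes P\<^sub>0: "P\<^sub>0 \<in> model" and A [measurable]: "A \<in> sets \<mu>" and V: "V \<subseteq> model"
    and \<kappa>: "0 < \<kappa>" "\<kappa> \<le> 1"
    and separated: "\<And>P. P \<in> V \<Longrightarrow> measure P\<^sub>0 A + 2 * \<kappa> \<le> measure P A"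
  obtains g \<gamma> where "g \<in> borel_measurable \<mu>" "\<And>x. 0 < g x" "0 \<le> \<gamma>" "\<gamma> < 1"
    "\<And>P. P \<in> V \<Longrightarrow> (\<integral>\<^sup>+ x. ennreal (g x) \<partial>P) \<le> ennreal \<gamma>"
    "(\<integral>\<^sup>+ x. ennreal (1 / g x) \<partial>P\<^sub>0) \<le> ennreal \<gamma>"
proof
  define t where "t = measure P\<^sub>0 A + \<kappa>"
  define \<Delta> where "\<Delta> x = \<kappa> / 16 * (indicator A x - t)" for x
  define \<gamma> where "\<gamma> = 1 - \<kappa>\<^sup>2 / 32"
  have t: "0 \<le> t" "t \<le> 2"
    using \<kappa> prob_space.prob_le_1[OF prob_space_model[OF P\<^sub>0], of A] by (auto simp: t_def)
  have \<Delta>: "\<bar>\<Delta> x\<bar> \<le> \<kappa> / 8" for x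
  proof -
    have "\<bar>\<Delta> x\<bar> \<le> \<kappa> / 16 * 2"
      unfolding \<Delta>_def abs_mult using t \<kappa> by (intro mult_mono) (auto simp: indicator_def)
    then show ?thesis by simp
  qed
  have \<Delta>_half: "\<bar>\<Delta> x\<bar> \<le> 1 / 2" for x
    using \<Delta>[of x] \<kappa> by linarith
  show "(\<lambda>x. 1 - \<Delta> x) \<in> borel_measurable \<mu>"
    unfolding \<Delta>_def by measurable
  show "0 < 1 - \<Delta> x" for x
    using \<Delta>_half[of x] by linarith
  have "\<kappa>\<^sup>2 \<le> 1"
    using \<kappa> by (simp add: power_le_one)
  then show "0 \<le> \<gamma>" "\<gamma> < 1"
    using \<kappa> by (auto simp: \<gamma>_def)
  have \<Delta>_integral: "integrable P \<Delta>" "(\<integral>x. \<Delta> x \<partial>P) = \<kappa> / 16 * (measure P A - t)" if P: "P \<in> model" for P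
  proof -
    interpret prob_space P
      using P by (rule prob_space_model)
    note [measurable_cong] = sets_model[OF P]
    show "integrable P \<Delta>" "(\<integral>x. \<Delta> x \<partial>P) = \<kappa> / 16 * (measure P A - t)"
      unfolding \<Delta>_def by (auto simp: prob_space emeasure_eq_measure)
  qed
  show "(\<integral>\<^sup>+ x. ennreal (1 - \<Delta> x) \<partial>P) \<le> ennreal \<gamma>" if P: "P \<in> V" for P
  proof -
    have P_model: "P \<in> model"
      using P V by auto
    then interpret prob_space P
      by (rule prob_space_model)
    have "\<Delta> x \<le> 1" for x
      using \<Delta>_half[of x] by linarith
    then have "(\<integral>\<^sup>+ x. ennreal (1 - \<Delta> x) \<partial>P) = ennreal (1 - \<kappa> / 16 * (measure P A - t))"
      using \<Delta>_integral[OF P_model] by (subst nn_integral_eq_integral) (auto simp: prob_space simp del: times_divide_eq_left)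
    also have "\<dots> \<le> ennreal \<gamma>"
    proof (rule ennreal_leI)
      have "\<kappa> / 16 * \<kappa> \<le> \<kappa> / 16 * (measure P A - t)"
        using separated[OF P] \<kappa> by (intro mult_left_mono) (auto simp: t_def)
      then show "1 - \<kappa> / 16 * (measure P A - t) \<le> \<gamma>"
        using zero_le_square[of \<kappa>] unfolding \<gamma>_def power2_eq_square by linarith
    qed
    finally show ?thesis .
  qed
  interpret P\<^sub>0: prob_space P\<^sub>0
    using P\<^sub>0 by (rule prob_space_model)
  have "(\<integral>\<^sup>+ x. ennreal (1 / (1 - \<Delta> x)) \<partial>P\<^sub>0) \<le> (\<integral>\<^sup>+ x. ennreal (1 + \<Delta> x + \<kappa>\<^sup>2 / 32) \<partial>P\<^sub>0)"
  proof (intro nn_integral_mono ennreal_leI)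
    fix x
    \<comment> \<open>By expansion, \<open>(1 + d + 2 * d\<^sup>2) * (1 - d) = 1 + d\<^sup>2 * (1 -
      2 * d)\<close>, which is at least 1 for \<open>d \<le> 1 / 2\<close>.\<close>
    have "0 \<le> (\<Delta> x)\<^sup>2 * (1 - 2 * \<Delta> x)"
      using \<Delta>_half[of x] by (intro mult_nonneg_nonneg) (auto simp: abs_le_iff)
    then have "1 / (1 - \<Delta> x) \<le> 1 + \<Delta> x + 2 * (\<Delta> x)\<^sup>2"
      using \<Delta>_half[of x] by (simp add: field_simps power2_eq_square abs_le_iff)
    moreover have "(\<Delta> x)\<^sup>2 \<le> (\<kappa> / 8)\<^sup>2"
      using \<Delta>[of x] \<kappa> by (intro abs_le_square_iff[THEN iffD1]) simp
    ultimately show "1 / (1 - \<Delta> x) \<le> 1 + \<Delta> x + \<kappa>\<^sup>2 / 32"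
      by (simp add: power_divide)
  qed
  also have "\<dots> = ennreal (1 + \<kappa> / 16 * (measure P\<^sub>0 A - t) + \<kappa>\<^sup>2 / 32)"
  proof (subst nn_integral_eq_integral)
    show "AE x in P\<^sub>0. 0 \<le> 1 + \<Delta> x + \<kappa>\<^sup>2 / 32"
    proof (rule AE_I2)
      show "0 \<le> 1 + \<Delta> x + \<kappa>\<^sup>2 / 32" for x
        using \<Delta>_half[of x] zero_le_power2[of \<kappa>] unfolding abs_le_iff by linarith
    qed
  qed (use \<Delta>_integral[OF P\<^sub>0] in \<open>auto simp: P\<^sub>0.prob_space simp del: times_divide_eq_left\<close>)
  also have "1 + \<kappa> / 16 * (measure P\<^sub>0 A - t) + \<kappa>\<^sup>2 / 32 = \<gamma>"
    by (simp add: t_def \<gamma>_def power2_eq_square)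
  finally show "(\<integral>\<^sup>+ x. ennreal (1 / (1 - \<Delta> x)) \<partial>P\<^sub>0) \<le> ennreal \<gamma>" .
qed

text \<open>The numerator is subadditive, and dividing by the common denominator distributes over
  the sum even when it is 0 or infinite.\<close>

lemma posterior_le_sum_cover:
  assumes A: "A \<subseteq> (\<Union>i\<in>I. V i)" and I: "finite I" and V: "\<And>i. i \<in> I \<Longrightarrow> V i \<in> sets prior"
    and \<omega>: "\<And>i. \<omega> i \<in> space \<mu>"
  shows "posterior p prior n \<omega> A \<le> (\<Sum>i\<in>I. posterior p prior n \<omega> (V i))"
proof -
  note [measurable] = V
  have [measurable]: "(\<lambda>P. p P (\<omega> i)) \<in> borel_measurable prior" for i
    using \<omega> by (intro density_measurable_Pair) auto
  have "(\<integral>\<^sup>+ P \<in> A. (\<Prod>i<n. ennreal (p P (\<omega> i))) \<partial>prior)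
      \<le> (\<integral>\<^sup>+ P. (\<Sum>j\<in>I. (\<Prod>i<n. ennreal (p P (\<omega> i))) * indicator (V j) P) \<partial>prior)"
  proof (intro nn_integral_mono)
    fix P
    show "(\<Prod>i<n. ennreal (p P (\<omega> i))) * indicator A P
        \<le> (\<Sum>j\<in>I. (\<Prod>i<n. ennreal (p P (\<omega> i))) * indicator (V j) P)"
    proof (cases "P \<in> A")
      case True
      then obtain j where "j \<in> I" "P \<in> V j"
        using A by auto
      then show ?thesis
        using I member_le_sum[of j I "\<lambda>j. (\<Prod>i<n. ennreal (p P (\<omega> i))) * indicator (V j) P"] True by simp
    qed simp
  qed
  also have "\<dots> = (\<Sum>j\<in>I. \<integral>\<^sup>+ P \<in> V j. (\<Prod>i<n. ennreal (p P (\<omega> i))) \<partial>prior)"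
    by (intro nn_integral_sum) measurable
  finally show ?thesis
    unfolding posterior_def divide_ennreal_def sum_distrib_right[symmetric] by (rule mult_right_mono) simp
qed

end

subsection \<open>Consistency\<close>

theorem theorem3p5:
  fixes \<mu> :: "'a measure"
    and model :: "'a measure set"
    and p :: "'a measure \<Rightarrow> 'a \<Rightarrow> real"
    and prior :: "'a measure measure"
    and P\<^sub>0 :: "'a measure"
    and r :: real
  assumes model: "dominated_bayes_model \<mu> model p prior"
    and r: "1 \<le> r"
    and metric: "Metric_space model (matusita_dist \<mu> p r)"
    and totally_bounded: "Metric_space.mtotally_bounded model (matusita_dist \<mu> p r) model"
    and P\<^sub>0: "P\<^sub>0 \<in> model"
    and predictive: "\<And>n. 1 \<le> n \<Longrightarrow>
          absolutely_continuous (prior_predictive prior n) (iid_sample P\<^sub>0 n)"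
    and prior_mass: "\<And>\<delta>. 0 < \<delta> \<Longrightarrow>
          0 < measure prior {P \<in> model. matusita_dist \<mu> p r P\<^sub>0 P < \<delta>}"
    and ratio: "\<exists>L>0. \<exists>\<eta>>0. \<forall>P\<in>model. \<forall>Q\<in>{Q \<in> model. matusita_dist \<mu> p r P\<^sub>0 Q < \<eta>}.
          likelihood_ratio_bounded p r L P\<^sub>0 P Q"
  shows "\<forall>\<epsilon>>0. AE \<omega> in iid_sequence P\<^sub>0.
          (\<lambda>n. posterior p prior n \<omega> {P \<in> model. matusita_dist \<mu> p r P P\<^sub>0 > \<epsilon>}) \<longlonglongrightarrow> 0"
proof (intro allI impI)
  fix \<epsilon> :: real
  assume \<epsilon>: "0 < \<epsilon>"
  interpret dominated_bayes_model \<mu> model p prior by fact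
  interpret Metric_space model "matusita_dist \<mu> p r" by fact
  let ?d = "matusita_dist \<mu> p r"
  have d_sets: "{P \<in> model. ?d P Q < c} \<in> sets prior" "{P \<in> model. c < ?d P Q} \<in> sets prior"
    if "Q \<in> model" for Q c
  proof -
    note [measurable] = matusita_dist_measurable[OF r that]
    show "{P \<in> model. ?d P Q < c} \<in> sets prior" "{P \<in> model. c < ?d P Q} \<in> sets prior"
      unfolding space_prior[symmetric] by measurable
  qed
  obtain L \<eta>\<^sub>0 where L: "0 < L" "0 < \<eta>\<^sub>0"
    and bounded: "\<And>Q. Q \<in> model \<Longrightarrow> ?d P\<^sub>0 Q < \<eta>\<^sub>0 \<Longrightarrow> likelihood_ratio_bounded p r L P\<^sub>0 P\<^sub>0 Q"
    using ratio P\<^sub>0 by blast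
  have neighbourhood: "\<exists>B\<in>sets prior. 0 < measure prior B \<and>
      (\<forall>Q\<in>B. (\<integral>\<^sup>+ x. ennreal (sqrt (p P\<^sub>0 x)) / ennreal (sqrt (p Q x)) \<partial>P\<^sub>0) \<le> ennreal (1 + \<eta>))"
    if \<eta>: "0 < \<eta>" for \<eta>
  proof -
    have M: "0 \<le> 1 + L + L powr (r / (r - 1))"
      using L by (simp add: add_nonneg_nonneg)
    obtain \<theta> where \<theta>: "0 < \<theta>"
      "\<And>Q. Q \<in> model \<Longrightarrow> (\<integral>\<^sup>+ x. ennreal (p P\<^sub>0 x) / ennreal (p Q x) \<partial>P\<^sub>0) \<le> ennreal (1 + L + L powr (r / (r - 1))) \<Longrightarrow>
        l1_dist P\<^sub>0 Q < \<theta> \<Longrightarrow>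
        (\<integral>\<^sup>+ x. ennreal (sqrt (p P\<^sub>0 x)) / ennreal (sqrt (p Q x)) \<partial>P\<^sub>0) \<le> ennreal (1 + \<eta>)"
      using sqrt_ratio_moment_small[OF P\<^sub>0 M \<eta>] by blast
    obtain \<rho> where \<rho>: "0 < \<rho>"
      "\<And>P Q. P \<in> model \<Longrightarrow> Q \<in> model \<Longrightarrow> ?d P Q < \<rho> \<Longrightarrow> l1_dist P Q < \<theta>"
      using l1_dist_small_of_matusita_dist_small[OF r \<theta>(1)] by blast
    \<comment> \<open>Radius \<open>\<rho>\<close> gives closeness in \<open>L^1\<close>, radius
      \<open>\<eta>\<^sub>0\<close> the moment bound.\<close>
    let ?B = "{P \<in> model. ?d P\<^sub>0 P < min \<rho> \<eta>\<^sub>0}"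
    have "?B \<in> sets prior"
      using d_sets(1)[OF P\<^sub>0, of "min \<rho> \<eta>\<^sub>0"] by (simp add: commute)
    moreover have "0 < measure prior ?B"
      using \<rho> L by (intro prior_mass) auto
    moreover have "(\<integral>\<^sup>+ x. ennreal (sqrt (p P\<^sub>0 x)) / ennreal (sqrt (p Q x)) \<partial>P\<^sub>0) \<le> ennreal (1 + \<eta>)"
      if "Q \<in> ?B" for Q
      using that \<theta>(2) \<rho>(2) P\<^sub>0 likelihood_ratio_bounded_imp_moment[OF P\<^sub>0 _ r L(1) bounded] by auto
    ultimately show ?thesis by blast
  qed

  \<comment> \<open>A distance \<open>d\<^sub>r\<close> above \<open>\<epsilon>\<close> forces an
    \<open>L^1\<close> distance above \<open>\<epsilon> powr r\<close>; the cap at 1 makes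
    \<open>\<theta> / 8\<close> an admissible \<open>\<kappa>\<close> for the test.\<close>
  define \<theta> where "\<theta> = min (\<epsilon> powr r) 1"
  have \<theta>: "0 < \<theta>" "\<theta> \<le> 1" "\<theta> \<le> \<epsilon> powr r"
    using \<epsilon> by (auto simp: \<theta>_def)
  have \<theta>_8: "0 < \<theta> / 8" "\<theta> / 8 \<le> 1"
    using \<theta> by simp_all
  obtain \<rho> where \<rho>: "0 < \<rho>"
    "\<And>P Q. P \<in> model \<Longrightarrow> Q \<in> model \<Longrightarrow> ?d P Q < \<rho> \<Longrightarrow> l1_dist P Q < \<theta> / 8"
    using l1_dist_small_of_matusita_dist_small[OF r \<theta>_8(1)] by blast
  obtain K where K: "finite K" "K \<subseteq> model" "model \<subseteq> (\<Union>P\<in>K. mball P \<rho>)"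
    using totally_bounded[unfolded mtotally_bounded_def, rule_format, OF \<rho>(1)] by (elim exE conjE)
  define V where "V P\<^sub>1 = {P \<in> model. ?d P P\<^sub>1 < \<rho>} \<inter> {P \<in> model. \<epsilon> < ?d P P\<^sub>0}" for P\<^sub>1
  have V_sets: "V P\<^sub>1 \<in> sets prior" if "P\<^sub>1 \<in> K" for P\<^sub>1
    unfolding V_def using that K P\<^sub>0 d_sets by auto
  have V_model: "V P\<^sub>1 \<subseteq> model" for P\<^sub>1
    by (auto simp: V_def)
  have far: "\<theta> < l1_dist P P\<^sub>0" if "P \<in> V P\<^sub>1" for P P\<^sub>1
  proof -
    have "\<epsilon> powr r < ?d P P\<^sub>0 powr r"
      using that \<epsilon> r by (intro powr_less_mono2) (auto simp: V_def)
    also have "\<dots> \<le> l1_dist P P\<^sub>0"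
      using that P\<^sub>0 by (intro matusita_dist_powr_le_l1_dist r) (auto simp: V_def)
    finally show ?thesis
      using \<theta> by simp
  qed
  have "AE \<omega> in iid_sequence P\<^sub>0. (\<lambda>n. posterior p prior n \<omega> (V P\<^sub>1)) \<longlonglongrightarrow> 0" if P\<^sub>1: "P\<^sub>1 \<in> K" for P\<^sub>1
  proof -
    have P\<^sub>1_model: "P\<^sub>1 \<in> model"
      using P\<^sub>1 K by auto
    obtain A where A: "A \<in> sets \<mu>" "l1_dist P\<^sub>1 P\<^sub>0 = 2 * (measure P\<^sub>1 A - measure P\<^sub>0 A)"
      using l1_dist_eq_measure_diff[OF P\<^sub>1_model P\<^sub>0] .
    \<comment> \<open>If \<open>V P\<^sub>1\<close> contains a point, the triangle inequality puts
      \<open>P\<^sub>1\<close> at \<open>L^1\<close> distance more than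
      \<open>7 * \<theta> / 8\<close> from \<open>P\<^sub>0\<close>, so \<open>A\<close> separates
      them by more than \<open>7 * \<theta> / 16\<close>. Passing from \<open>P\<^sub>1\<close> to
      \<open>P\<close> costs less than \<open>\<theta> / 8\<close>, which leaves more than
      \<open>\<theta> / 4\<close>.\<close>
    have separated: "measure P\<^sub>0 A + 2 * (\<theta> / 8) \<le> measure P A" if P: "P \<in> V P\<^sub>1" for P
    proof -
      have P_model: "P \<in> model" and near: "l1_dist P P\<^sub>1 < \<theta> / 8"
        using P P\<^sub>1_model \<rho> by (auto simp: V_def)
      have "l1_dist P P\<^sub>0 \<le> l1_dist P P\<^sub>1 + l1_dist P\<^sub>1 P\<^sub>0"
        using P_model P\<^sub>1_model P\<^sub>0 by (rule l1_dist_triangle)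
      moreover have "measure P\<^sub>1 A - measure P A \<le> l1_dist P P\<^sub>1"
        using measure_diff_le_l1_dist[OF P\<^sub>1_model P_model A(1)] by (simp add: l1_dist_commute)
      ultimately show ?thesis
        using far[OF P] near A(2) \<theta>(1) by (simp add: field_simps)
    qed
    obtain g \<gamma> where test: "g \<in> borel_measurable \<mu>" "\<And>x. 0 < g x" "0 \<le> \<gamma>" "\<gamma> < 1"
      "\<And>P. P \<in> V P\<^sub>1 \<Longrightarrow> (\<integral>\<^sup>+ x. ennreal (g x) \<partial>P) \<le> ennreal \<gamma>"
      "(\<integral>\<^sup>+ x. ennreal (1 / g x) \<partial>P\<^sub>0) \<le> ennreal \<gamma>"
      using test_of_separation[OF P\<^sub>0 A(1) V_model \<theta>_8 separated] by blast
    then show ?thesis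
      by (intro posterior_tendsto_0_of_test[OF P\<^sub>0 V_sets[OF P\<^sub>1] test(1) _ test(3-6) neighbourhood])
  qed
  then have "AE \<omega> in iid_sequence P\<^sub>0. \<forall>P\<^sub>1\<in>K. (\<lambda>n. posterior p prior n \<omega> (V P\<^sub>1)) \<longlonglongrightarrow> 0"
    using K by (intro AE_finite_allI)
  then show "AE \<omega> in iid_sequence P\<^sub>0. (\<lambda>n. posterior p prior n \<omega> {P \<in> model. ?d P P\<^sub>0 > \<epsilon>}) \<longlonglongrightarrow> 0"
    using AE_space
  proof eventually_elim
    case (elim \<omega>)
    have \<omega>: "\<omega> i \<in> space \<mu>" for i
      using elim(2) sets_eq_imp_space_eq[OF sets_model[OF P\<^sub>0]] by (auto simp: iid_sequence_def space_PiM)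
    have cover: "{P \<in> model. ?d P P\<^sub>0 > \<epsilon>} \<subseteq> (\<Union>P\<^sub>1\<in>K. V P\<^sub>1)"
    proof
      fix P assume P: "P \<in> {P \<in> model. ?d P P\<^sub>0 > \<epsilon>}"
      then obtain P\<^sub>1 where "P\<^sub>1 \<in> K" "P \<in> mball P\<^sub>1 \<rho>"
        using K by auto
      then have "P \<in> V P\<^sub>1"
        using P commute[of P P\<^sub>1] by (simp add: V_def)
      with \<open>P\<^sub>1 \<in> K\<close> show "P \<in> (\<Union>P\<^sub>1\<in>K. V P\<^sub>1)"
        by blast
    qed
    have "(\<lambda>n. \<Sum>P\<^sub>1\<in>K. posterior p prior n \<omega> (V P\<^sub>1)) \<longlonglongrightarrow> (\<Sum>P\<^sub>1\<in>K. 0)"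
      using elim(1) by (intro tendsto_sum) auto
    then have limit: "(\<lambda>n. \<Sum>P\<^sub>1\<in>K. posterior p prior n \<omega> (V P\<^sub>1)) \<longlonglongrightarrow> 0"
      by simp
    have le: "posterior p prior n \<omega> {P \<in> model. ?d P P\<^sub>0 > \<epsilon>} \<le> (\<Sum>P\<^sub>1\<in>K. posterior p prior n \<omega> (V P\<^sub>1))" for n
      using cover K(1) V_sets \<omega> by (rule posterior_le_sum_cover)
    show ?case
      by (rule tendsto_sandwich[OF _ _ tendsto_const limit]) (simp_all add: le)
  qed
qed

end
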